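(* For every $\omega\in[0,1]$, Bob has a one-jump strategy with gain $5|P|/9$ for the cutting of the pizza into $15$ slices whose sizes, in circular order, are $$P_\omega=0,0,1,0,1,0,0,1+\omega,0,2-\omega,0,0,2,0,2.$$ Moreover, up to scaling all sizes by a positive factor, rotating, and reversing the circular order, the cuttings $P_\omega$ ($\omega\in[0,1]$) are all the cuttings of the pizza into $15$ slices for which Bob has a strategy with gain $5|P|/9$.
   Context: The pizza game: a pizza is cut into $n\ge1$ slices forming a circular sequence $P=p_0p_1\dots p_{n-1}$ (indices modulo $n$, $p_i$ adjacent to $p_{i\pm1}$), each slice having a size $|p_i|\ge 0$; $|P|=\sum_i|p_i|$. Alice and Bob alternately take slices, one per turn, Alice first. In the first turn Alice may take any slice; in every later turn the player must take a slice that has a neighbor already taken. For $1<j\le n$, if a player took $p_i$ in turn $j-1$ and the other player takes $p_{i-1}$ or $p_{i+1}$ in turn $j$, turn $j$ is a shift; otherwise it is a jump. A strategy of a player is a $j$-jump strategy if it makes at most $j$ jumps of that player. A strategy has gain $g$ if it guarantees the player a set of slices of total size at least $g$, whatever the opponent does.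
   Formalization: The characterization is stated for cuttings with |P| > 0; the all-zero cutting is excluded, since there Bob trivially has gain 0 = 5|P|/9 although it is not a positive multiple of any P_ω. *)

theory Defs
  imports Complex_Main
begin

text \<open>A cutting of the pizza is the list of the slice sizes in circular order, so that the slice
  with index \<open>i\<close> has size \<open>P ! i\<close> and indices are read modulo \<open>length P\<close>.
  The total size is \<open>sum_list P\<close>.\<close>

definition pizza :: "real list \<Rightarrow> bool" where
  "pizza P \<longleftrightarrow> P \<noteq> [] \<and> (\<forall>x\<in>set P. 0 \<le> x)"

definition adjacent :: "nat \<Rightarrow> nat \<Rightarrow> nat \<Rightarrow> bool" where
  "adjacent n i i' \<longleftrightarrow> i' = (i + 1) mod n \<or> i = (i' + 1) mod n"

text \<open>A position of the game on \<open>n\<close> slices is the list of the slices taken so far in the order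
  in which they were taken; turn \<open>j\<close> of the game is entry \<open>j - 1\<close> of this list.\<close>

definition legal_move :: "nat \<Rightarrow> nat list \<Rightarrow> nat \<Rightarrow> bool" where
  "legal_move n h i \<longleftrightarrow>
     i < n \<and> i \<notin> set h \<and> (h = [] \<or> (\<exists>i'\<in>set h. adjacent n i i'))"

inductive position :: "nat \<Rightarrow> nat list \<Rightarrow> bool" for n :: nat where
  start: "position n []"
| move: "position n h \<Longrightarrow> legal_move n h i \<Longrightarrow> position n (h @ [i])"

datatype player = Alice | Bob

text \<open>The player who moves when \<open>k\<close> slices have been taken.\<close>

definition mover :: "nat \<Rightarrow> player" where
  "mover k = (if even k then Alice else Bob)"

definition strategy :: "player \<Rightarrow> nat \<Rightarrow> (nat list \<Rightarrow> nat) \<Rightarrow> bool" where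
  "strategy pl n \<sigma> \<longleftrightarrow>
     (\<forall>h. position n h \<and> length h < n \<and> mover (length h) = pl \<longrightarrow> legal_move n h (\<sigma> h))"

text \<open>A finished game in which \<open>pl\<close> follows \<open>\<sigma>\<close> and the opponent plays arbitrarily.\<close>

definition game_with :: "player \<Rightarrow> nat \<Rightarrow> (nat list \<Rightarrow> nat) \<Rightarrow> nat list \<Rightarrow> bool" where
  "game_with pl n \<sigma> h \<longleftrightarrow>
     position n h \<and> length h = n \<and> (\<forall>k<n. mover k = pl \<longrightarrow> h ! k = \<sigma> (take k h))"

text \<open>The first turn is neither a shift nor a jump, hence \<open>0 < k\<close>.\<close>

definition jumps :: "player \<Rightarrow> nat \<Rightarrow> nat list \<Rightarrow> nat" where
  "jumps pl n h =
     card {k. 0 < k \<and> k < length h \<and> mover k = pl \<and> \<not> adjacent n (h ! (k - 1)) (h ! k)}"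

definition jump_strategy :: "player \<Rightarrow> nat \<Rightarrow> nat \<Rightarrow> (nat list \<Rightarrow> nat) \<Rightarrow> bool" where
  "jump_strategy pl j n \<sigma> \<longleftrightarrow>
     strategy pl n \<sigma> \<and> (\<forall>h. game_with pl n \<sigma> h \<longrightarrow> jumps pl n h \<le> j)"

definition taken_size :: "player \<Rightarrow> real list \<Rightarrow> nat list \<Rightarrow> real" where
  "taken_size pl P h = (\<Sum>k | k < length h \<and> mover k = pl. P ! (h ! k))"

definition has_gain :: "player \<Rightarrow> real list \<Rightarrow> (nat list \<Rightarrow> nat) \<Rightarrow> real \<Rightarrow> bool" where
  "has_gain pl P \<sigma> g \<longleftrightarrow> (\<forall>h. game_with pl (length P) \<sigma> h \<longrightarrow> g \<le> taken_size pl P h)"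

definition P_cut :: "real \<Rightarrow> real list" where
  "P_cut \<omega> = [0, 0, 1, 0, 1, 0, 0, 1 + \<omega>, 0, 2 - \<omega>, 0, 0, 2, 0, 2]"

text \<open>Equality of cuttings up to scaling by a positive factor, rotating and reversing.\<close>

definition similar :: "real list \<Rightarrow> real list \<Rightarrow> bool" where
  "similar P Q \<longleftrightarrow>
     (\<exists>c>0. \<exists>k. P = map (\<lambda>x. c * x) (rotate k Q) \<or> P = map (\<lambda>x. c * x) (rotate k (rev Q)))"

end

theory Submission
  imports Defs
begin

text \<open>
  Bob has gain \<open>5|P|/9\<close> iff he can keep Alice at \<open>4|P|/9\<close>. If Alice only shifts, she ends up with a
  half-circle: eight consecutive slices in the order \<open>v\<^sub>j = p\<^sub>2\<^sub>j\<close> (indices modulo \<open>15\<close>). Starting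
  anywhere, she therefore shows that the half-circles of size at most \<open>4|P|/9\<close> cover the pizza, and
  three of them suffice. Their starting points in \<open>v\<close>-order are at most \<open>6\<close> apart, since two
  half-circles that are \<open>7\<close> or \<open>8\<close> apart already cover everything. Taking a triple of least total
  size, the gaps are, up to symmetry, \<open>(6,5,4)\<close>, \<open>(6,6,3)\<close> or \<open>(5,5,5)\<close>.

  Every other plan of Alice (a first slice, and a reply to each remaining arc and move of Bob) has a
  finite list of outcomes, one of which must again be of size at most \<open>4|P|/9\<close>. A computer search
  found a tree of such case distinctions in which linear inequalities refute every branch
  but one, where they force \<open>P\<close> to be a multiple of some \<open>P\<^sub>\<omega>\<close>.

  Conversely, the sizes in \<open>P\<^sub>\<omega>\<close> are affine in \<open>\<omega>\<close>, so that a one-jump strategy that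
  is good enough for \<open>\<omega> = 0\<close> and for \<open>\<omega> = 1\<close> is good enough in between.
\<close>

section \<open>Remaining arcs\<close>

lemma position_legal: "position n h \<Longrightarrow> k < length h \<Longrightarrow> legal_move n (take k h) (h ! k)"
proof (induction arbitrary: k rule: position.induct)
  case (move h i)
  then show ?case
    by (cases "k = length h") (auto simp: nth_append)
qed simp

lemma position_take: "position n h \<Longrightarrow> position n (take k h)"
proof (induction rule: position.induct)
  case (move h i)
  then show ?case
    using position.move[OF move.hyps] by (cases "k \<le> length h") auto
qed (simp add: position.start)

lemma position_distinct: "position n h \<Longrightarrow> distinct h \<and> set h \<subseteq> {..<n}"
  by (induction rule: position.induct) (auto simp: legal_move_def)

text \<open>Exactly the slices \<open>a, \<dots>, a + l - 1\<close> are left; \<open>a\<close> itself is not reduced modulo \<open>n\<close>.\<close>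

definition arc_left :: "nat \<Rightarrow> nat list \<Rightarrow> nat \<Rightarrow> nat \<Rightarrow> bool" where
  "arc_left n h a l \<longleftrightarrow>
     position n h \<and> l < n \<and> length h + l = n \<and>
     (\<forall>i<n. i \<in> set h \<longleftrightarrow> i \<notin> (\<lambda>k. (a + k) mod n) ` {..<l})"

lemma add_mod_inject:
  fixes n :: nat
  assumes "(a + j) mod n = (a + k) mod n" "j < n" "k < n"
  shows "j = k"
  using assms
proof (induction j k rule: linorder_wlog)
  case (le j k)
  then have "n dvd k - j"
    using mod_eq_dvd_iff_nat[of "a + j" "a + k" n] by simp
  then show ?case
    using le by (cases "k = j") (auto dest!: dvd_imp_le)
qed simp

text \<open>An inner slice of the arc has both neighbors in the arc, so nothing next to it is taken.
  Each end touches a taken slice because the arc is not the whole circle.\<close>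

lemma legal_move_arc:
  assumes arc: "arc_left n h a (Suc l)"
  shows "legal_move n h i \<longleftrightarrow> i = a mod n \<or> i = (a + l) mod n"
proof
  have l: "Suc l < n" and h: "h \<noteq> []"
    and set_h: "\<And>i. i < n \<Longrightarrow> i \<in> set h \<longleftrightarrow> i \<notin> (\<lambda>k. (a + k) mod n) ` {..<Suc l}"
    using arc by (auto simp: arc_left_def)
  have taken: "(a + k) mod n \<in> set h" if "Suc l \<le> k" "k < n" for k
    using that l by (auto simp: set_h dest: add_mod_inject)
  show "i = a mod n \<or> i = (a + l) mod n" if legal: "legal_move n h i"
  proof -
    obtain i' where i': "i' \<in> set h" "adjacent n i i'" and i: "i < n" "i \<notin> set h"
      using legal h by (auto simp: legal_move_def)
    have "i' < n"
      using i' arc position_distinct by (auto simp: arc_left_def)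
    obtain k where k: "k \<le> l" "i = (a + k) mod n"
      using i set_h by (auto simp: less_Suc_eq_le)
    have "k = 0 \<or> k = l"
    proof (rule ccontr)
      assume "\<not> (k = 0 \<or> k = l)"
      then have k': "0 < k" "k < l" using k by auto
      have "i' = (a + Suc k) mod n \<or> i' = (a + (k - 1)) mod n"
        using i'(2) unfolding adjacent_def
      proof
        assume "i' = (i + 1) mod n"
        then show ?thesis using k by (simp add: mod_Suc_eq)
      next
        assume "i = (i' + 1) mod n"
        then have "(1 + i') mod n = (1 + (a + (k - 1)) mod n) mod n"
          using k k' by (simp add: mod_Suc_eq)
        then have "i' = (a + (k - 1)) mod n"
          by (rule add_mod_inject) (use \<open>i' < n\<close> in auto)
        then show ?thesis ..
      qed
      then have "\<exists>j<Suc l. i' = (a + j) mod n"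
        using k' by (auto intro: exI[of _ "Suc k"] exI[of _ "k - 1"])
      then have "i' \<in> (\<lambda>k. (a + k) mod n) ` {..<Suc l}"
        by blast
      then show False
        using i' set_h \<open>i' < n\<close> by blast
    qed
    then show ?thesis using k by auto
  qed
  show "legal_move n h i" if "i = a mod n \<or> i = (a + l) mod n"
    using that
  proof
    assume i: "i = a mod n"
    have "i \<notin> set h"
      using l i by (auto simp: set_h intro!: image_eqI[of _ _ 0])
    moreover have "adjacent n i ((a + (n - 1)) mod n)"
      using l i by (simp add: adjacent_def mod_Suc_eq)
    ultimately show ?thesis
      using taken[of "n - 1"] l i by (auto simp: legal_move_def)
  next
    assume i: "i = (a + l) mod n"
    have "i \<notin> set h"
      using l i by (auto simp: set_h)
    moreover have "adjacent n i ((a + Suc l) mod n)"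
      using i by (simp add: adjacent_def mod_Suc_eq)
    ultimately show ?thesis
      using taken[of "Suc l"] l i by (auto simp: legal_move_def)
  qed
qed

lemma arc_left_start: "i < n \<Longrightarrow> arc_left n [i] (Suc i) (n - 1)"
proof -
  assume i: "i < n"
  have "j = i \<longleftrightarrow> j \<notin> (\<lambda>k. (Suc i + k) mod n) ` {..<n - 1}" if "j < n" for j
  proof
    assume "j = i"
    have False if k: "k < n - 1" "i = (Suc i + k) mod n" for k
    proof -
      have "Suc k < n" using k by simp
      then show False using add_mod_inject[of i 0 n "Suc k"] k i by simp
    qed
    then show "j \<notin> (\<lambda>k. (Suc i + k) mod n) ` {..<n - 1}"
      using \<open>j = i\<close> by auto
  next
    assume *: "j \<notin> (\<lambda>k. (Suc i + k) mod n) ` {..<n - 1}"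
    show "j = i"
    proof (rule ccontr)
      assume "j \<noteq> i"
      define k where "k = (if i < j then j - Suc i else j + n - Suc i)"
      have "k < n - 1" "(Suc i + k) mod n = j"
        using \<open>j \<noteq> i\<close> i \<open>j < n\<close> by (auto simp: k_def)
      then show False using * by auto
    qed
  qed
  moreover have "position n [i]"
    using position.move[OF position.start, of n i] i by (simp add: legal_move_def)
  ultimately show ?thesis
    using i by (auto simp: arc_left_def)
qed

lemma arc_left_snoc:
  assumes arc: "arc_left n h a (Suc l)" and legal: "legal_move n h x"
    and split: "(\<lambda>k. (a + k) mod n) ` {..<Suc l} = insert x ((\<lambda>k. (b + k) mod n) ` {..<l})"
    and new: "\<And>k. k < l \<Longrightarrow> x \<noteq> (b + k) mod n"
  shows "arc_left n (h @ [x]) b l"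
proof -
  define B where "B = (\<lambda>k. (b + k) mod n) ` {..<l}"
  have "x \<notin> B" using new by (auto simp: B_def)
  moreover have "\<forall>i<n. i \<in> set h \<longleftrightarrow> i \<notin> insert x B"
    using arc split by (simp add: arc_left_def B_def)
  ultimately have "\<forall>i<n. i \<in> set (h @ [x]) \<longleftrightarrow> i \<notin> B" by auto
  then show ?thesis
    using arc position.move[OF _ legal] by (simp add: arc_left_def B_def)
qed

lemma arc_left_take_left:
  assumes "arc_left n h a (Suc l)"
  shows "arc_left n (h @ [a mod n]) (Suc a) l"
proof (rule arc_left_snoc[OF assms])
  have "{..<Suc l} = insert 0 (Suc ` {..<l})"
    by (auto simp: image_iff less_Suc_eq_0_disj)
  then show "(\<lambda>k. (a + k) mod n) ` {..<Suc l} =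
      insert (a mod n) ((\<lambda>k. (Suc a + k) mod n) ` {..<l})"
    by (simp add: image_image)
  show "a mod n \<noteq> (Suc a + k) mod n" if "k < l" for k
    using assms that add_mod_inject[of a 0 n "Suc k"] by (auto simp: arc_left_def)
qed (simp add: legal_move_arc[OF assms])

lemma arc_left_take_right:
  assumes "arc_left n h a (Suc l)"
  shows "arc_left n (h @ [(a + l) mod n]) a l"
proof (rule arc_left_snoc[OF assms])
  show "(a + l) mod n \<noteq> (a + k) mod n" if "k < l" for k
    using assms that add_mod_inject[of a l n k] by (auto simp: arc_left_def)
qed (simp_all add: legal_move_arc[OF assms] lessThan_Suc)

text \<open>Induction on the game: the first slice leaves an arc, and every further legal move cuts
  off one of its ends.\<close>

lemma position_arc:
  assumes "position n h" "h \<noteq> []"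
  shows "\<exists>a. arc_left n h a (n - length h)"
  using assms
proof (induction rule: position.induct)
  case (move h i)
  show ?case
  proof (cases "h = []")
    case True
    then show ?thesis
      using move arc_left_start[of i n] by (auto simp: legal_move_def)
  next
    case False
    then obtain a where a: "arc_left n h a (n - length h)" using move by auto
    have "set h \<noteq> {..<n}" using move by (auto simp: legal_move_def)
    then have "n - length h \<noteq> 0"
      using a position_distinct[of n h] by (auto simp: arc_left_def)
    then obtain l where l: "n - length h = Suc l" by (cases "n - length h") auto
    then have "n - length (h @ [i]) = l" by simp
    then show ?thesis
      using move legal_move_arc[of n h a l i] a l arc_left_take_left[of n h a l]
        arc_left_take_right[of n h a l] by auto
  qed
qed simp

lemma exists_legal_move:
  assumes "position n h" "length h < n"
  shows "\<exists>i. legal_move n h i"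
proof (cases "h = []")
  case True
  then show ?thesis using assms by (auto simp: legal_move_def)
next
  case False
  then obtain a where "arc_left n h a (n - length h)" using position_arc assms by blast
  then show ?thesis
    using assms legal_move_arc[of n h a "n - length h - 1"] by (auto simp: Suc_diff_Suc)
qed

lemma game_taken_size:
  assumes "position (length P) h" "length h = length P"
  shows "taken_size Alice P h + taken_size Bob P h = sum_list P"
proof -
  have h: "distinct h" "set h \<subseteq> {..<length P}" using position_distinct assms by auto
  then have "set h = {..<length P}"
    using assms by (intro card_subset_eq) (auto simp: distinct_card)
  then have "sum_list P = (\<Sum>i\<in>set h. P ! i)"
    by (simp add: sum_list_sum_nth lessThan_atLeast0)
  also have "\<dots> = (\<Sum>k<length h. P ! (h ! k))"
    using h sum.reindex[of "(!) h" "{..<length h}" "(!) P"] inj_on_nth[of h "{..<length h}"]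
    by (simp add: nth_image lessThan_atLeast0 flip: set_conv_nth)
  also have "\<dots> = (\<Sum>k | k < length h \<and> mover k = Alice. P ! (h ! k)) +
      (\<Sum>k | k < length h \<and> mover k = Bob. P ! (h ! k))"
    by (subst sum.union_disjoint[symmetric]) (auto intro!: sum.cong simp: mover_def)
  finally show ?thesis by (simp add: taken_size_def)
qed

lemma taken_size_snoc:
  "taken_size pl P (h @ [i]) = taken_size pl P h + (if mover (length h) = pl then P ! i else 0)"
proof -
  have "{k. k < length (h @ [i]) \<and> mover k = pl} =
      {k. k < length h \<and> mover k = pl} \<union> (if mover (length h) = pl then {length h} else {})"
    by (auto simp: less_Suc_eq)
  moreover have "(\<Sum>k | k < length h \<and> mover k = pl. P ! ((h @ [i]) ! k)) = taken_size pl P h"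
    unfolding taken_size_def by (rule sum.cong) (auto simp: nth_append)
  ultimately show ?thesis
    by (simp add: taken_size_def sum.union_disjoint)
qed

section \<open>Strategies of Bob\<close>

definition good_for_Bob :: "real list \<Rightarrow> bool" where
  "good_for_Bob P \<longleftrightarrow>
     (\<exists>\<sigma>. strategy Bob (length P) \<sigma> \<and> has_gain Bob P \<sigma> (5 * sum_list P / 9))"

section \<open>Invariance under rotation, reversal and scaling\<close>

definition symmetry :: "nat \<Rightarrow> (nat \<Rightarrow> nat) \<Rightarrow> (nat \<Rightarrow> nat) \<Rightarrow> bool" where
  "symmetry n f g \<longleftrightarrow>
     (\<forall>i<n. f i < n \<and> g i < n \<and> g (f i) = i \<and> f (g i) = i) \<and>
     (\<forall>i<n. \<forall>j<n. adjacent n i j \<longrightarrow> adjacent n (f i) (f j) \<and> adjacent n (g i) (g j))"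

lemma symmetry_swap: "symmetry n f g \<Longrightarrow> symmetry n g f"
  by (auto simp: symmetry_def)

lemma legal_move_map:
  assumes sym: "symmetry n f g" and h: "set h \<subseteq> {..<n}" and legal: "legal_move n h i"
  shows "legal_move n (map f h) (f i)"
proof -
  have "i < n" using legal by (simp add: legal_move_def)
  moreover have "f i \<noteq> f j" if "j \<in> set h" for j
  proof
    assume "f i = f j"
    then have "g (f i) = g (f j)" by simp
    then show False
      using sym h that legal by (auto simp: symmetry_def legal_move_def subset_iff)
  qed
  ultimately show ?thesis
  proof -
    have "\<exists>j\<in>set h. adjacent n (f i) (f j)" if nonempty: "h \<noteq> []"
    proof -
      obtain j where "j \<in> set h" "adjacent n i j"
        using legal nonempty by (auto simp: legal_move_def)
      then show ?thesis
        using sym h \<open>i < n\<close> by (auto simp: symmetry_def intro!: bexI[of _ j])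
    qed
    then show ?thesis
      using \<open>i < n\<close> sym \<open>\<And>j. j \<in> set h \<Longrightarrow> f i \<noteq> f j\<close>
      by (auto simp: legal_move_def symmetry_def)
  qed
qed

lemma position_map:
  assumes "symmetry n f g" "position n h"
  shows "position n (map f h)"
  using assms(2)
proof (induction rule: position.induct)
  case (move h i)
  then show ?case
    using legal_move_map[OF assms(1)] position_distinct by (auto intro!: position.move)
qed (simp add: position.start)

text \<open>Bob carries the history over to \<open>P\<close> by \<open>f\<close>, looks up the reply
  of his strategy there and carries it back by the inverse \<open>g\<close>.\<close>

lemma good_for_Bob_reindex:
  assumes sym: "symmetry n f g" and good: "good_for_Bob P"
    and len: "length P = n" "length Q = n" and sum: "sum_list Q = sum_list P"
    and Q: "\<And>i. i < n \<Longrightarrow> Q ! i = P ! f i"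
  shows "good_for_Bob Q"
proof -
  obtain \<sigma> where \<sigma>: "strategy Bob n \<sigma>" "has_gain Bob P \<sigma> (5 * sum_list P / 9)"
    using good len by (auto simp: good_for_Bob_def)
  define \<tau> where "\<tau> h = g (\<sigma> (map f h))" for h
  have legal: "legal_move n (map f h) (\<sigma> (map f h))"
    if "position n h" "length h < n" "mover (length h) = Bob" for h
    using \<sigma>(1) that position_map[OF sym] by (auto simp: strategy_def)
  have "legal_move n h (\<tau> h)"
    if h: "position n h" "length h < n" "mover (length h) = Bob" for h
  proof -
    have "set h \<subseteq> {..<n}" using position_distinct h by auto
    then have "map g (map f h) = h"
      using sym by (auto simp: symmetry_def subset_iff intro: map_idI)
    moreover have "set (map f h) \<subseteq> {..<n}"
      using position_distinct position_map[OF sym h(1)] by blast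
    ultimately show ?thesis
      using legal_move_map[OF symmetry_swap[OF sym] _ legal[OF h]] by (simp add: \<tau>_def)
  qed
  then have "strategy Bob n \<tau>" by (simp add: strategy_def)
  moreover have "has_gain Bob Q \<tau> (5 * sum_list Q / 9)"
    unfolding has_gain_def len
  proof (intro allI impI)
    fix h assume h: "game_with Bob n \<tau> h"
    then have pos: "position n h" "length h = n" by (auto simp: game_with_def)
    have "map f h ! k = \<sigma> (take k (map f h))" if k: "k < n" "mover k = Bob" for k
    proof -
      have "legal_move n (map f (take k h)) (\<sigma> (map f (take k h)))"
        using legal[OF position_take[OF pos(1)], of k] k pos by simp
      then have "f (\<tau> (take k h)) = \<sigma> (map f (take k h))"
        using sym by (simp add: \<tau>_def legal_move_def symmetry_def)
      then show ?thesis
        using h k pos by (simp add: game_with_def take_map)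
    qed
    then have "game_with Bob n \<sigma> (map f h)"
      using position_map[OF sym pos(1)] pos by (simp add: game_with_def)
    then have "5 * sum_list P / 9 \<le> taken_size Bob P (map f h)"
      using \<sigma>(2) len by (simp add: has_gain_def)
    also have "taken_size Bob P (map f h) = taken_size Bob Q h"
      using Q position_distinct[OF pos(1)] pos
      by (auto simp: taken_size_def subset_iff intro!: sum.cong)
    finally show "5 * sum_list Q / 9 \<le> taken_size Bob Q h" using sum by simp
  qed
  ultimately show ?thesis using len by (auto simp: good_for_Bob_def)
qed

lemma good_for_Bob_rotate1:
  assumes "good_for_Bob P"
  shows "good_for_Bob (rotate1 P)"
proof -
  define n where "n = length P"
  have f: "Suc ((i + (n - 1)) mod n) mod n = i" "(Suc i mod n + (n - 1)) mod n = i" if "i < n" for i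
  proof -
    have "Suc i + (n - 1) = i + n" "Suc (i + (n - 1)) = i + n" using that by auto
    then show "Suc ((i + (n - 1)) mod n) mod n = i" "(Suc i mod n + (n - 1)) mod n = i"
      using that by (simp_all only: mod_Suc_eq mod_add_left_eq) simp_all
  qed
  define F where "F i = Suc i mod n" for i
  define G where "G i = (i + (n - 1)) mod n" for i
  have "F (G i) = i" "G (F i) = i" "F i < n" "G i < n" if "i < n" for i
    using f[OF that] that by (simp_all add: F_def G_def)
  note FG = this
  have adj: "adjacent n i j \<longleftrightarrow> j = F i \<or> i = F j" for i j
    by (simp add: adjacent_def F_def)
  have "adjacent n (F i) (F j) \<and> adjacent n (G i) (G j)"
    if "i < n" "j < n" "adjacent n i j" for i j
    using that(3) unfolding adj
  proof
    assume j: "j = F i"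
    show "(F j = F (F i) \<or> F i = F (F j)) \<and> (G j = F (G i) \<or> G i = F (G j))"
      unfolding j using FG[OF \<open>i < n\<close>] by simp
  next
    assume i: "i = F j"
    show "(F j = F (F i) \<or> F i = F (F j)) \<and> (G j = F (G i) \<or> G i = F (G j))"
      unfolding i using FG[OF \<open>j < n\<close>] by simp
  qed
  then have "symmetry n F G"
    using FG by (simp add: symmetry_def)
  moreover have "sum_list (rotate1 P) = sum_list P"
    by (cases P) auto
  ultimately show ?thesis
    using assms by - (rule good_for_Bob_reindex[of n F G P], auto simp: n_def nth_rotate1 F_def)
qed

lemma good_for_Bob_rev:
  assumes "good_for_Bob P"
  shows "good_for_Bob (rev P)"
proof -
  define n where "n = length P"
  have "adjacent n (n - Suc i) (n - Suc j)" if "i < n" "j < n" "adjacent n i j" for i j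
  proof -
    have "n - Suc i = (n - Suc ((i + 1) mod n) + 1) mod n" if "i < n" for i
      using that by (cases "Suc i = n") (auto simp: Suc_diff_Suc)
    note eq = this
    show ?thesis
      using that(3) unfolding adjacent_def
    proof
      assume "j = (i + 1) mod n"
      then show "n - Suc j = (n - Suc i + 1) mod n \<or> n - Suc i = (n - Suc j + 1) mod n"
        using eq[OF that(1)] by metis
    next
      assume "i = (j + 1) mod n"
      then show "n - Suc j = (n - Suc i + 1) mod n \<or> n - Suc i = (n - Suc j + 1) mod n"
        using eq[OF that(2)] by metis
    qed
  qed
  then have "symmetry n (\<lambda>i. n - Suc i) (\<lambda>i. n - Suc i)"
    by (auto simp: symmetry_def)
  then show ?thesis
    using assms by (rule good_for_Bob_reindex) (auto simp: n_def rev_nth)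
qed

lemma good_for_Bob_scale:
  assumes "good_for_Bob P" "0 < c"
  shows "good_for_Bob (map (\<lambda>x. c * x) P)"
proof -
  obtain \<sigma> where \<sigma>: "strategy Bob (length P) \<sigma>" "has_gain Bob P \<sigma> (5 * sum_list P / 9)"
    using assms by (auto simp: good_for_Bob_def)
  have "5 * sum_list (map (\<lambda>x. c * x) P) / 9 \<le> taken_size Bob (map (\<lambda>x. c * x) P) h"
    if h: "game_with Bob (length P) \<sigma> h" for h
  proof -
    have "length h = length P" "set h \<subseteq> {..<length P}"
      using h position_distinct by (auto simp: game_with_def)
    then have "taken_size Bob (map (\<lambda>x. c * x) P) h = c * taken_size Bob P h"
      by (auto simp: taken_size_def subset_iff sum_distrib_left intro!: sum.cong)
    moreover have "c * (5 * sum_list P / 9) \<le> c * taken_size Bob P h"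
      using \<sigma>(2) h assms(2) by (intro mult_left_mono) (auto simp: has_gain_def)
    ultimately show ?thesis by (simp add: sum_list_const_mult)
  qed
  then show ?thesis
    using \<sigma>(1) by (auto simp: good_for_Bob_def has_gain_def)
qed

lemma good_for_Bob_rotate: "good_for_Bob P \<Longrightarrow> good_for_Bob (rotate k P)"
  by (induction k) (auto simp: good_for_Bob_rotate1)

lemma good_for_Bob_similar:
  assumes "similar P Q" "good_for_Bob Q"
  shows "good_for_Bob P"
  using assms good_for_Bob_scale good_for_Bob_rotate good_for_Bob_rev
  by (auto simp: similar_def)

text \<open>The invariant is tested only after Alice's turns. For odd \<open>n\<close> the last turn
  is hers, so it reaches the final position.\<close>

lemma strategy_from_invariant:
  assumes start: "\<And>i. i < n \<Longrightarrow> J [i]"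
    and step: "\<And>h. position n h \<Longrightarrow> odd (length h) \<Longrightarrow> length h < n \<Longrightarrow> J h \<Longrightarrow>
      \<exists>i. legal_move n h i \<and> (\<forall>i'. legal_move n (h @ [i]) i' \<longrightarrow> J (h @ [i, i']))"
  shows "\<exists>\<sigma>. strategy Bob n \<sigma> \<and> (\<forall>h. game_with Bob n \<sigma> h \<and> odd n \<longrightarrow> J h)"
proof -
  define Q where "Q h i \<longleftrightarrow> legal_move n h i \<and> (\<forall>i'. legal_move n (h @ [i]) i' \<longrightarrow> J (h @ [i, i']))" for h i
  \<comment> \<open>A strategy has to be legal in positions off the invariant as well; there any
    legal move will do.\<close>
  define \<sigma> where "\<sigma> h = (if \<exists>i. Q h i then SOME i. Q h i else SOME i. legal_move n h i)" for h
  have Q: "Q h (\<sigma> h)" if "\<exists>i. Q h i" for h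
    using someI_ex[OF that] that by (simp add: \<sigma>_def)
  have "strategy Bob n \<sigma>"
    unfolding strategy_def
  proof (intro allI impI)
    fix h assume h: "position n h \<and> length h < n \<and> mover (length h) = Bob"
    show "legal_move n h (\<sigma> h)"
    proof (cases "\<exists>i. Q h i")
      case True
      then show ?thesis using Q[OF True] by (simp add: Q_def)
    next
      case False
      then show ?thesis
        using someI_ex[OF exists_legal_move[of n h]] h by (simp add: \<sigma>_def)
    qed
  qed
  moreover have "J h" if h: "game_with Bob n \<sigma> h" and "odd n" for h
  proof -
    have pos: "position n h" and len: "length h = n"
      using h by (auto simp: game_with_def)
    have "J (take (2 * k + 1) h)" if "2 * k + 1 \<le> n" for k
      using that
    proof (induction k)
      case 0
      then have "legal_move n [] (h ! 0)" "take 1 h = [h ! 0]"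
        using position_legal[OF pos, of 0] len by (auto simp: take_Suc_conv_app_nth)
      then show ?case using start by (simp add: legal_move_def)
    next
      case (Suc k)
      define p where "p = take (2 * k + 1) h"
      have "\<exists>i. Q p i"
        unfolding Q_def
        by (rule step) (use Suc len position_take[OF pos] in \<open>auto simp: p_def\<close>)
      moreover have "h ! (2 * k + 1) = \<sigma> p"
        using h Suc.prems by (simp add: game_with_def mover_def p_def)
      moreover have "take (2 * Suc k + 1) h = p @ [h ! (2 * k + 1), h ! (2 * k + 2)]"
        using Suc.prems len by (simp add: p_def take_Suc_conv_app_nth)
      moreover have "legal_move n (p @ [h ! (2 * k + 1)]) (h ! (2 * k + 2))"
        using position_legal[OF pos, of "2 * k + 2"] Suc.prems len
        by (simp add: p_def take_Suc_conv_app_nth)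
      ultimately show ?case using Q by (auto simp: Q_def)
    qed
    from this[of "(n - 1) div 2"] show ?thesis using \<open>odd n\<close> len by (auto elim: oddE)
  qed
  ultimately show ?thesis by blast
qed

section \<open>Plans of Alice and their outcomes\<close>

definition dot :: "int list \<Rightarrow> real list \<Rightarrow> real" where
  "dot v P = (\<Sum>i<length P. of_int (v ! i) * P ! i)"

text \<open>A set of slices is represented by the integer vector \<open>v\<close> with entries \<open>4 - 9 = - 5\<close> inside and
  \<open>4\<close> outside, so that \<open>dot v P \<ge> 0\<close> says that its size is at most \<open>4|P|/9\<close>. Moving a
  slice into the set is a charge of \<open>9\<close>.\<close>

definition charge :: "nat \<Rightarrow> int list \<Rightarrow> int list" where
  "charge i v = v[i mod length v := v ! (i mod length v) - 9]"

text \<open>A plan of Alice is to shift, except that she takes the opposite end of the remaining arc when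
  \<open>(a, m, b) \<in> set s\<close>, where \<open>a\<close> and \<open>2 * m + 2\<close> are the first slice and the length of the arc
  before Bob's move and \<open>b\<close> says whether Bob took its left end. The argument \<open>X\<close> lists the
  possible pairs of the first slice of the remaining arc, of length \<open>2 * m\<close>, and the vector of
  Alice's slices; removing duplicates after each round keeps it short.\<close>

fun plays :: "(nat \<times> nat \<times> bool) list \<Rightarrow> nat \<Rightarrow> (nat \<times> int list) list \<Rightarrow> (nat \<times> int list) list" where
  "plays s 0 X = X"
| "plays s (Suc m) X = plays s m (remdups (concat (map (\<lambda>(a, v).
     [if (a, m, True) \<in> set s then (Suc a, charge (a + 2 * m + 1) v) else (a + 2, charge (a + 1) v),
      if (a, m, False) \<in> set s then (Suc a, charge a v) else (a, charge (a + 2 * m) v)]) X)))"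

definition outcomes :: "nat \<Rightarrow> nat \<Rightarrow> (nat \<times> nat \<times> bool) list \<Rightarrow> int list list" where
  "outcomes n i s = remdups (map snd (plays s ((n - 1) div 2) [(Suc i, charge i (replicate n 4))]))"

text \<open>The numbers in \<open>Farkas\<close> and \<open>Target\<close> are positions in the list of the vectors known to have
  nonnegative product with \<open>P\<close>, the latest outcome first.\<close>

datatype cert =
    Farkas "nat list"
  | Target "(int \<times> nat list) list"
  | Play nat "(nat \<times> nat \<times> bool) list" "cert list"

text \<open>Repeating a position in \<open>ks\<close> acts as an integer multiplier.\<close>

definition combine :: "nat \<Rightarrow> int list list \<Rightarrow> nat list \<Rightarrow> int list" where
  "combine n C ks = foldr (\<lambda>k. map2 (+) (C ! k)) ks (replicate n 0)"

text \<open>A \<open>Farkas\<close> leaf adds known vectors up to one with only negative entries,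
  impossible for positive total size. A \<open>Target\<close> leaf bounds a positive multiple of
  each goal vector from below by such a sum. In a \<open>Play\<close> node outcomes may share a
  certificate, so \<open>cs\<close> is a pool, not a list parallel to the outcomes.\<close>

fun check :: "nat \<Rightarrow> int list list \<Rightarrow> int list list \<Rightarrow> cert \<Rightarrow> bool" where
  "check n ts C (Farkas ks) \<longleftrightarrow>
     list_all (\<lambda>k. k < length C) ks \<and> list_all (\<lambda>x. x < 0) (combine n C ks)"
| "check n ts C (Target ws) \<longleftrightarrow>
     list_all2 (\<lambda>t (d, ks). 0 < d \<and> list_all (\<lambda>k. k < length C) ks \<and>
       list_all2 (\<lambda>x y. x \<le> d * y) (combine n C ks) t) ts ws"
| "check n ts C (Play i s cs) \<longleftrightarrow>
     i < n \<and> list_all (\<lambda>v. list_ex (check n ts (v # C)) cs) (outcomes n i s)"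

section \<open>Soundness of plans and certificates\<close>

lemma length_charge [simp]: "length (charge i v) = length v"
  by (simp add: charge_def)

lemma dot_charge:
  assumes "length v = length P" "P \<noteq> []"
  shows "dot (charge i v) P = dot v P - 9 * P ! (i mod length P)"
proof -
  define j where "j = i mod length P"
  have j: "j < length P" using assms by (simp add: j_def)
  have "dot (charge i v) P = (\<Sum>k<length P. of_int (v ! k) * P ! k - (if k = j then 9 * P ! k else 0))"
    unfolding dot_def using assms by (intro sum.cong) (auto simp: charge_def j_def algebra_simps)
  then show ?thesis
    using j by (simp add: sum_subtractf dot_def flip: j_def)
qed

text \<open>Follow one game against \<open>\<sigma>\<close>: in each round Bob's actual move selects
  one of the two branches, and the slice with which Alice answers is charged, so
  \<open>dot v P\<close> keeps pace with \<open>taken_size\<close>. The constant \<open>t\<close> is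
  the value with nothing charged.\<close>

lemma plays_sound:
  assumes \<sigma>: "strategy Bob n \<sigma>" and n: "odd n" "length P = n"
    and "arc_left n h a (2 * m)" "\<And>k. k < length h \<Longrightarrow> mover k = Bob \<Longrightarrow> h ! k = \<sigma> (take k h)"
    and "(a, v) \<in> set X" "length v = n" "dot v P = t - 9 * taken_size Alice P h"
  shows "\<exists>h' a' v'. game_with Bob n \<sigma> h' \<and> (a', v') \<in> set (plays s m X) \<and> length v' = n \<and>
    dot v' P = t - 9 * taken_size Alice P h'"
  using assms(4-)
proof (induction m arbitrary: h a v X)
  case 0
  then have "game_with Bob n \<sigma> h"
    by (auto simp: game_with_def arc_left_def)
  then show ?case using 0 by auto
next
  case (Suc m)
  define Y where "Y = remdups (concat (map (\<lambda>(a, v).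
     [if (a, m, True) \<in> set s then (Suc a, charge (a + 2 * m + 1) v) else (a + 2, charge (a + 1) v),
      if (a, m, False) \<in> set s then (Suc a, charge a v) else (a, charge (a + 2 * m) v)]) X))"
  have arc: "arc_left n h a (Suc (2 * m + 1))" using Suc.prems by simp
  have pos: "position n h" "length h < n" and odd: "odd (length h)"
    using arc \<open>odd n\<close> by (auto simp: arc_left_def)
  define i where "i = \<sigma> h"
  have "legal_move n h i"
    using \<sigma> pos odd by (simp add: strategy_def mover_def i_def)
  then have i: "i = a mod n \<or> i = (a + (2 * m + 1)) mod n"
    using legal_move_arc[OF arc] by blast
  \<comment> \<open>All four combinations of Bob's end and Alice's answer continue in this way;
    \<open>x\<close> is the unreduced index of her slice.\<close>
  have next_round: ?case
    if next_arc: "arc_left n (h @ [i] @ [x mod n]) a' (2 * m)" and mem: "(a', charge x v) \<in> set Y" for a' x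
  proof -
    have "\<exists>h' a' v'. game_with Bob n \<sigma> h' \<and> (a', v') \<in> set (plays s m Y) \<and> length v' = n \<and>
        dot v' P = t - 9 * taken_size Alice P h'"
    proof (rule Suc.IH[OF next_arc _ mem])
      show "(h @ [i] @ [x mod n]) ! k = \<sigma> (take k (h @ [i] @ [x mod n]))"
        if "k < length (h @ [i] @ [x mod n])" "mover k = Bob" for k
        using that Suc.prems(2)[of k] odd
        by (auto simp: nth_append i_def mover_def less_Suc_eq split: if_splits)
      have "taken_size Alice P (h @ [i] @ [x mod n]) = taken_size Alice P h + P ! (x mod n)"
        using taken_size_snoc[of Alice P "h @ [i]" "x mod n"] taken_size_snoc[of Alice P h i] odd
        by (simp add: mover_def)
      then show "dot (charge x v) P = t - 9 * taken_size Alice P (h @ [i] @ [x mod n])"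
        using Suc.prems n by (subst dot_charge) (auto elim: oddE)
    qed (use Suc.prems in simp)
    then show ?thesis by (simp add: Y_def)
  qed
  from i show ?case
  proof
    assume i: "i = a mod n"
    have arc': "arc_left n (h @ [i]) (Suc a) (Suc (2 * m))"
      using arc_left_take_left[OF arc] i by simp
    show ?case
    proof (cases "(a, m, True) \<in> set s")
      case True
      then have "(Suc a, charge (a + 2 * m + 1) v) \<in> set Y"
        using Suc.prems(3) by (force simp: Y_def)
      then show ?thesis
        using next_round[of "a + 2 * m + 1" "Suc a"] arc_left_take_right[OF arc'] by simp
    next
      case False
      then have "(a + 2, charge (a + 1) v) \<in> set Y"
        using Suc.prems(3) by (force simp: Y_def)
      then show ?thesis
        using next_round[of "a + 1" "a + 2"] arc_left_take_left[OF arc'] by simp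
    qed
  next
    assume i: "i = (a + (2 * m + 1)) mod n"
    have arc': "arc_left n (h @ [i]) a (Suc (2 * m))"
      using arc_left_take_right[OF arc] i by simp
    show ?case
    proof (cases "(a, m, False) \<in> set s")
      case True
      then have "(Suc a, charge a v) \<in> set Y"
        using Suc.prems(3) by (force simp: Y_def)
      then show ?thesis
        using next_round[of a "Suc a"] arc_left_take_left[OF arc'] by simp
    next
      case False
      then have "(a, charge (a + 2 * m) v) \<in> set Y"
        using Suc.prems(3) by (force simp: Y_def)
      then show ?thesis
        using next_round[of "a + 2 * m" a] arc_left_take_right[OF arc'] by simp
    qed
  qed
qed

lemma good_for_Bob_outcomes:
  assumes "good_for_Bob P" and n: "odd n" "length P = n" and i: "i < n"
  shows "\<exists>v\<in>set (outcomes n i s). length v = n \<and> 0 \<le> dot v P"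
proof -
  obtain \<sigma> where \<sigma>: "strategy Bob n \<sigma>" "has_gain Bob P \<sigma> (5 * sum_list P / 9)"
    using assms by (auto simp: good_for_Bob_def)
  have "dot (replicate n 4) P = 4 * sum_list P"
    using n by (simp add: dot_def sum_list_sum_nth sum_distrib_left lessThan_atLeast0)
  then have "dot (charge i (replicate n 4)) P = 4 * sum_list P - 9 * taken_size Alice P [i]"
    using taken_size_snoc[of Alice P "[]" i] n i
    by (subst dot_charge) (auto simp: taken_size_def mover_def)
  then obtain h' a' v' where *: "game_with Bob n \<sigma> h'" "length v' = n"
      "(a', v') \<in> set (plays s ((n - 1) div 2) [(Suc i, charge i (replicate n 4))])"
      "dot v' P = 4 * sum_list P - 9 * taken_size Alice P h'"
    using plays_sound[OF \<sigma>(1) n, of "[i]" "Suc i" "(n - 1) div 2" "charge i (replicate n 4)"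
        "[(Suc i, charge i (replicate n 4))]" "4 * sum_list P" s] arc_left_start[OF i] n
    by (auto simp: mover_def)
  have "5 * sum_list P / 9 \<le> taken_size Bob P h'"
    using \<sigma>(2) *(1) n by (simp add: has_gain_def)
  moreover have "taken_size Alice P h' + taken_size Bob P h' = sum_list P"
    using *(1) n by (intro game_taken_size) (auto simp: game_with_def)
  ultimately have "0 \<le> dot v' P" using *(4) by simp
  then show ?thesis using * by (force simp: outcomes_def)
qed

lemma dot_combine:
  assumes "\<forall>c\<in>set C. length c = length P \<and> 0 \<le> dot c P" "\<forall>k\<in>set ks. k < length C"
  shows "length (combine (length P) C ks) = length P \<and> 0 \<le> dot (combine (length P) C ks) P"
  using assms(2)
proof (induction ks)
  case Nil
  then show ?case by (simp add: combine_def dot_def)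
next
  case (Cons k ks)
  define v where "v = combine (length P) C ks"
  have C: "length (C ! k) = length P" "0 \<le> dot (C ! k) P"
    using Cons.prems assms(1) by auto
  have v: "length v = length P" "0 \<le> dot v P" using Cons by (auto simp: v_def)
  have "combine (length P) C (k # ks) = map2 (+) (C ! k) v"
    by (simp add: combine_def v_def)
  moreover have "dot (map2 (+) (C ! k) v) P = dot (C ! k) P + dot v P"
    using C v by (simp add: dot_def distrib_right sum.distrib)
  ultimately show ?case using C v by simp
qed

lemma dot_mono:
  assumes "\<And>i. i < length P \<Longrightarrow> v ! i \<le> w ! i" "\<forall>x\<in>set P. 0 \<le> x"
  shows "dot v P \<le> dot w P"
  unfolding dot_def using assms by (intro sum_mono mult_right_mono) auto

text \<open>Negative integers are at most -1, which bounds the product by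
  \<open>- sum_list P\<close>.\<close>

lemma dot_negative:
  assumes "\<And>i. i < length P \<Longrightarrow> v ! i < 0" "\<forall>x\<in>set P. 0 \<le> x" "0 < sum_list P"
  shows "dot v P < 0"
proof -
  have "dot v P \<le> (\<Sum>i<length P. - (P ! i))"
    unfolding dot_def
  proof (rule sum_mono)
    fix i assume "i \<in> {..<length P}"
    then have "real_of_int (v ! i) \<le> -1" "0 \<le> P ! i" using assms(1)[of i] assms(2) by auto
    then show "real_of_int (v ! i) * P ! i \<le> - (P ! i)"
      using mult_right_mono[of "real_of_int (v ! i)" "-1" "P ! i"] by simp
  qed
  also have "\<dots> = - sum_list P"
    by (simp add: sum_negf sum_list_sum_nth lessThan_atLeast0)
  finally show ?thesis using assms by simp
qed

text \<open>In a \<open>Play\<close> node some outcome \<open>v\<close> has a nonnegative product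
  with \<open>P\<close>; the certificate matching it is applied with \<open>v\<close> added to the
  context. At a \<open>Farkas\<close> leaf the hypotheses are contradictory.\<close>

lemma check_sound:
  assumes good: "good_for_Bob P" and P: "odd (length P)" "\<forall>x\<in>set P. 0 \<le> x" "0 < sum_list P"
    and "check (length P) ts C c" "\<forall>v\<in>set C. length v = length P \<and> 0 \<le> dot v P" "t \<in> set ts"
  shows "0 \<le> dot t P"
  using assms(5-)
proof (induction "length P" ts C c rule: check.induct)
  case (1 ts C ks)
  define v where "v = combine (length P) C ks"
  have v: "length v = length P" "0 \<le> dot v P"
    using 1 dot_combine[of C P ks] by (auto simp: v_def list_all_iff)
  have "v ! i < 0" if "i < length P" for i
    using 1 that v by (auto simp: list_all_iff simp flip: v_def)
  then have "dot v P < 0"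
    using P by (intro dot_negative) auto
  then show ?case using v by simp
next
  case (2 ts C ws)
  obtain d ks where w: "0 < d" "\<forall>k\<in>set ks. k < length C"
      "list_all2 (\<lambda>x y. x \<le> d * y) (combine (length P) C ks) t"
  proof -
    obtain j where j: "j < length ts" "t = ts ! j"
      using 2(3) by (auto simp: in_set_conv_nth)
    obtain d ks where "ws ! j = (d, ks)" by fastforce
    then show thesis
      using list_all2_nthD[OF 2(1)[unfolded check.simps] j(1)] j that[of d ks]
      by (simp add: list_all_iff)
  qed
  define v where "v = combine (length P) C ks"
  have v: "length v = length P" "0 \<le> dot v P"
    using 2 w dot_combine[of C P ks] by (auto simp: v_def)
  then have "dot v P \<le> dot (map ((*) d) t) P"
    using P w(3) by (intro dot_mono) (auto simp: list_all2_conv_all_nth simp flip: v_def)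
  also have "\<dots> = of_int d * dot t P"
    using v w(3) by (auto simp: dot_def sum_distrib_left list_all2_lengthD mult.assoc simp flip: v_def)
  finally have "0 \<le> of_int d * dot t P" using v by linarith
  then show ?case using w(1) by (simp add: zero_le_mult_iff)
next
  case (3 ts C i s cs)
  then obtain v where v: "v \<in> set (outcomes (length P) i s)" "length v = length P" "0 \<le> dot v P"
    using good_for_Bob_outcomes[OF good P(1) refl, of i s] by auto
  then obtain c where "c \<in> set cs" "check (length P) ts (v # C) c"
    using 3 by (auto simp: list_all_iff list_ex_iff)
  then show ?case
    using 3 v by simp
qed

section \<open>Triples of half-circles\<close>

text \<open>In this section \<open>h j\<close> stands for \<open>4|P|\<close> minus \<open>9\<close> times the size of the half-circle that starts
  at \<open>v\<^sub>j\<close>.\<close>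

definition spread :: "int \<Rightarrow> int \<Rightarrow> int \<Rightarrow> bool" where
  "spread x y z \<longleftrightarrow>
     (y - x) mod 15 \<in> {1..6} \<and> (z - y) mod 15 \<in> {1..6} \<and> (x - z) mod 15 \<in> {1..6}"

definition candidate :: "(int \<Rightarrow> real) \<Rightarrow> int \<Rightarrow> int \<Rightarrow> int \<Rightarrow> bool" where
  "candidate h x y z \<longleftrightarrow> spread x y z \<and> 0 \<le> h x \<and> 0 \<le> h y \<and> 0 \<le> h z"

text \<open>Large values of \<open>h\<close> belong to small half-circles, so this is a triple of
  least total size. Its optimality later supplies inequalities between half-circles with nearby
  starts.\<close>

definition best :: "(int \<Rightarrow> real) \<Rightarrow> int \<Rightarrow> int \<Rightarrow> int \<Rightarrow> bool" where
  "best h x y z \<longleftrightarrow> candidate h x y z \<and>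
     (\<forall>x' y' z'. candidate h x' y' z' \<longrightarrow> h x' + h y' + h z' \<le> h x + h y + h z)"

lemma best_cycle: "best h x y z \<Longrightarrow> best h y z x"
  by (auto simp: best_def candidate_def spread_def algebra_simps)

lemma candidate_shift: "candidate (\<lambda>j. h (s + j)) x y z \<longleftrightarrow> candidate h (s + x) (s + y) (s + z)"
  by (simp add: candidate_def spread_def)

lemma best_shift: "best (\<lambda>j. h (s + j)) x y z \<longleftrightarrow> best h (s + x) (s + y) (s + z)"
proof -
  have "(\<forall>x' y' z'. candidate h x' y' z' \<longrightarrow> h x' + h y' + h z' \<le> c) \<longleftrightarrow>
      (\<forall>x' y' z'. candidate h (s + x') (s + y') (s + z') \<longrightarrow> h (s + x') + h (s + y') + h (s + z') \<le> c)" for c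
    by (metis add.commute diff_add_cancel)
  then show ?thesis by (simp add: best_def candidate_shift)
qed

lemma candidate_reflect: "candidate (\<lambda>j. h (- j)) x y z \<longleftrightarrow> candidate h (- x) (- z) (- y)"
  by (auto simp: candidate_def spread_def)

lemma best_reflect: "best (\<lambda>j. h (- j)) x y z \<longleftrightarrow> best h (- x) (- z) (- y)"
proof -
  have "(\<forall>x' y' z'. candidate h x' y' z' \<longrightarrow> h x' + h y' + h z' \<le> c) \<longleftrightarrow>
      (\<forall>x' y' z'. candidate h (- x') (- z') (- y') \<longrightarrow> h (- x') + h (- y') + h (- z') \<le> c)" for c
  proof (intro iffI allI impI)
    fix x' y' z'
    assume "\<forall>x' y' z'. candidate h x' y' z' \<longrightarrow> h x' + h y' + h z' \<le> c"
      "candidate h (- x') (- z') (- y')"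
    then have "h (- x') + h (- z') + h (- y') \<le> c" by blast
    then show "h (- x') + h (- y') + h (- z') \<le> c" by simp
  next
    fix x' y' z'
    assume *: "\<forall>x' y' z'. candidate h (- x') (- z') (- y') \<longrightarrow> h (- x') + h (- y') + h (- z') \<le> c"
      and "candidate h x' y' z'"
    then show "h x' + h y' + h z' \<le> c"
      using *[rule_format, of "- x'" "- y'" "- z'"] by simp
  qed
  then show ?thesis by (simp add: best_def candidate_reflect add_ac)
qed

lemma best_exchange:
  assumes "best h x y z" "spread x' y z"
  shows "h x' \<le> h x"
proof (cases "0 \<le> h x'")
  case True
  then have "candidate h x' y z" using assms by (auto simp: best_def candidate_def)
  then have "h x' + h y + h z \<le> h x + h y + h z" using assms(1) unfolding best_def by blast
  then show ?thesis by simp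
qed (use assms in \<open>auto simp: best_def candidate_def\<close>)

lemma mod_by_gap:
  fixes x y n d :: int
  shows "(y - x) mod n = d \<Longrightarrow> y mod n = (x + d) mod n"
  by (metis add_diff_cancel_left' diff_add_cancel mod_add_right_eq add.commute)

lemma mod_by_gaps:
  fixes x y z n d e :: int
  shows "(y - x) mod n = d \<Longrightarrow> (z - y) mod n = e \<Longrightarrow> z mod n = (x + (d + e)) mod n"
  by (metis mod_by_gap mod_add_left_eq add.assoc)

text \<open>With gaps 5, 5, 5 every rotation looks alike, so the order of the values picks one
  rotation and direction. In \<open>P_cut \<omega>\<close> the half-circles at 3, 8, 13 have sizes
  4, 3, 2; this offset therefore leads to \<open>P_cut \<omega>\<close> itself and not to a rotation
  of it.\<close>

definition normal_form :: "(int \<Rightarrow> real) \<Rightarrow> bool" where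
  "normal_form h \<longleftrightarrow> best h 0 6 11 \<or> best h 0 6 12 \<or> best h 3 8 13 \<and> h 3 \<le> h 8 \<and> h 8 \<le> h 13"

section \<open>Optimal triples and their normal forms\<close>

locale periodic15 =
  fixes h :: "int \<Rightarrow> real"
  assumes period: "h (j mod 15) = h j"
begin

lemma candidate_mod: "candidate h (x mod 15) (y mod 15) (z mod 15) \<longleftrightarrow> candidate h x y z"
  by (simp add: candidate_def spread_def period mod_diff_eq)

lemma exists_best:
  assumes "candidate h x y z"
  shows "\<exists>x y z. best h x y z"
proof -
  define S where "S = (\<lambda>(x, y, z). h x + h y + h z) `
      {(x, y, z). x \<in> {0..<15} \<and> y \<in> {0..<15} \<and> z \<in> {0..<15} \<and> candidate h x y z}"
  have "finite {(x, y, z). x \<in> {0..<15::int} \<and> y \<in> {0..<15::int} \<and> z \<in> {0..<15::int} \<and> candidate h x y z}"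
    by (rule finite_subset[of _ "{0..<15} \<times> {0..<15} \<times> {0..<15}"]) auto
  then have S: "finite S" by (simp add: S_def)
  have mem: "h x + h y + h z \<in> S" if "candidate h x y z" for x y z
    using that candidate_mod[of x y z] unfolding S_def
    by (auto intro!: image_eqI[of _ _ "(x mod 15, y mod 15, z mod 15)"] simp: period)
  then have "Max S \<in> S" using S assms by (auto intro!: Max_in)
  then obtain x y z where "candidate h x y z" "h x + h y + h z = Max S"
    by (auto simp: S_def)
  then have "best h x y z" using mem S by (auto simp: best_def)
  then show ?thesis by blast
qed

lemma best_cong:
  assumes "best h x y z" "x mod 15 = x' mod 15" "y mod 15 = y' mod 15" "z mod 15 = z' mod 15"
  shows "best h x' y' z'"
proof -
  have "candidate h x' y' z' \<longleftrightarrow> candidate h x y z"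
    using candidate_mod[of x y z] candidate_mod[of x' y' z'] assms by simp
  moreover have "h x' = h x" "h y' = h y" "h z' = h z"
    using assms period by metis+
  ultimately show ?thesis using assms(1) by (simp add: best_def)
qed

text \<open>The half-circle from \<open>s - t\<close> with \<open>t\<close> between 0 and 7 contains
  \<open>v\<^sub>s\<close>, so \<open>cover\<close> says that the small half-circles cover the
  pizza; \<open>no_7\<close> and \<open>no_8\<close> keep the gaps down to 6.\<close>

lemma candidate_exists:
  assumes cover: "\<And>s. \<exists>t\<in>{0..7}. 0 \<le> h (s - t)"
    and no_7: "\<And>j. h j + h (j + 7) < 0" and no_8: "\<And>j. h j + h (j + 8) < 0"
  shows "\<exists>x y z. candidate h x y z"
proof -
  obtain x where x: "0 \<le> h x" using cover[of 0] by auto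
  have next_one: "\<exists>d\<in>{1..6}. 0 \<le> h (y + d) \<and> (\<forall>e\<in>{d+1..8}. h (y + e) < 0)" if y: "0 \<le> h y" for y
  proof -
    define D where "D = {d\<in>{1..8}. 0 \<le> h (y + d)}"
    have "finite D" by (rule finite_subset[of _ "{1..8}"]) (auto simp: D_def)
    \<comment> \<open>Covering place \<open>y + 8\<close> takes a start among the eight places after
      \<open>y\<close>.\<close>
    obtain t where "t \<in> {0..7}" "0 \<le> h (y + 8 - t)" using cover[of "y + 8"] by auto
    then have "8 - t \<in> D" by (simp add: D_def add_diff_eq)
    then have Max: "Max D \<in> D" using \<open>finite D\<close> by (auto intro!: Max_in)
    have "h (y + 7) < 0" "h (y + 8) < 0" using no_7[of y] no_8[of y] y by auto
    then have "Max D \<noteq> 7" "Max D \<noteq> 8" using Max by (auto simp: D_def)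
    then have "Max D \<in> {1..6}" using Max by (auto simp: D_def)
    moreover have "h (y + e) < 0" if "e \<in> {Max D + 1..8}" for e
    proof (rule ccontr)
      assume "\<not> h (y + e) < 0"
      then have "e \<in> D" using that Max by (auto simp: D_def)
      then show False using Max_ge[OF \<open>finite D\<close>] that by fastforce
    qed
    ultimately show ?thesis using Max by (auto simp: D_def)
  qed
  \<comment> \<open>Going from \<open>x\<close> to the farthest start within reach, twice, leads into the last \<open>6\<close> places
    before \<open>x + 15\<close>.\<close>
  obtain d where d: "d \<in> {1..6}" "0 \<le> h (x + d)" "\<And>e. e \<in> {d+1..8} \<Longrightarrow> h (x + e) < 0"
    using next_one[OF x] by blast
  obtain d' where d': "d' \<in> {1..6}" "0 \<le> h (x + d + d')"
    using next_one[OF d(2)] by blast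
  \<comment> \<open>No start between \<open>x + d\<close> and \<open>x + 8\<close> qualifies, so the
    next one lies beyond; the third gap \<open>15 - d - d'\<close> is then at most 6.\<close>
  have "9 \<le> d + d'" using d(3)[of "d + d'"] d' by (fastforce simp: add.assoc)
  have "(x - (x + d + d')) mod 15 = ((15 - d - d') - 15) mod 15"
    by simp
  also have "\<dots> = 15 - d - d'"
    unfolding minus_mod_self2 using d(1) d'(1) by (intro mod_pos_pos_trivial) auto
  finally have "candidate h x (x + d) (x + d + d')"
    using x d d' \<open>9 \<le> d + d'\<close> by (auto simp: candidate_def spread_def)
  then show ?thesis by blast
qed

lemma best_normal_direct:
  assumes best: "best h x y z"
    and "(y - x) mod 15 = 6 \<and> (z - y) mod 15 \<in> {5, 6} \<or>
      (y - x) mod 15 = 5 \<and> (z - y) mod 15 = 5 \<and> h x \<le> h y \<and> h y \<le> h z"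
  shows "\<exists>s. normal_form (\<lambda>j. h (s + j))"
  using assms(2)
proof
  assume gaps: "(y - x) mod 15 = 6 \<and> (z - y) mod 15 \<in> {5, 6}"
  have y: "y mod 15 = (x + 6) mod 15"
    using gaps mod_by_gap by blast
  have "z mod 15 = (x + 11) mod 15 \<or> z mod 15 = (x + 12) mod 15"
    using gaps mod_by_gaps[of y x 15 6 z 5] mod_by_gaps[of y x 15 6 z 6] by auto
  then have "best (\<lambda>j. h (x + j)) 0 6 11 \<or> best (\<lambda>j. h (x + j)) 0 6 12"
    using best_cong[OF best _ y] by (auto simp: best_shift)
  then show ?thesis by (auto simp: normal_form_def)
next
  assume gaps: "(y - x) mod 15 = 5 \<and> (z - y) mod 15 = 5 \<and> h x \<le> h y \<and> h y \<le> h z"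
  have mods: "x mod 15 = (x - 3 + 3) mod 15" "y mod 15 = (x - 3 + 8) mod 15" "z mod 15 = (x - 3 + 13) mod 15"
    using gaps mod_by_gap[of y x 15 5] mod_by_gaps[of y x 15 5 z 5] by (simp_all add: add.commute)
  then have "best (\<lambda>j. h (x - 3 + j)) 3 8 13"
    unfolding best_shift by (rule best_cong[OF best])
  moreover have "h x = h (x - 3 + 3)" "h y = h (x - 3 + 8)" "h z = h (x - 3 + 13)"
    using mods period by metis+
  ultimately have "normal_form (\<lambda>j. h (x - 3 + j))"
    using gaps by (simp add: normal_form_def)
  then show ?thesis ..
qed

lemma best_normal:
  assumes best: "best h x y z"
  shows "\<exists>s. normal_form (\<lambda>j. h (s + j)) \<or> normal_form (\<lambda>j. h (s - j))"
proof -
  define g where "g = (\<lambda>j. h (- j))"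
  interpret g: periodic15 g
  proof
    show "g (j mod 15) = g j" for j
      using period[of "- (j mod 15)"] period[of "- j"] by (simp add: g_def mod_minus_eq)
  qed
  have g: "best g (- x) (- z) (- y)" using best by (simp add: g_def best_reflect)
  have reflected: ?thesis if normal: "\<exists>s. normal_form (\<lambda>j. g (s + j))"
  proof -
    obtain s where "normal_form (\<lambda>j. g (s + j))" using normal by blast
    then have "normal_form (\<lambda>j. h (- s - j))" by (simp add: g_def)
    then show ?thesis by blast
  qed
  have gval: "g (- x) = h x" "g (- y) = h y" "g (- z) = h z" by (simp_all add: g_def)
  note direct = best_normal_direct[OF best] best_normal_direct[OF best_cycle[OF best]]
    best_normal_direct[OF best_cycle[OF best_cycle[OF best]]]
  note mirror = g.best_normal_direct[OF g] g.best_normal_direct[OF best_cycle[OF g]]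
    g.best_normal_direct[OF best_cycle[OF best_cycle[OF g]]]
  define b c d where "b = (y - x) mod 15" and "c = (z - y) mod 15" and "d = (x - z) mod 15"
  have mirror_gaps: "(- z - - x) mod 15 = d" "(- y - - z) mod 15 = c" "(- x - - y) mod 15 = b"
    by (simp_all add: b_def c_def d_def)
  have bcd: "b \<in> {1..6}" "c \<in> {1..6}" "d \<in> {1..6}"
    using best by (auto simp: best_def candidate_def spread_def b_def c_def d_def)
  have "(b + c) mod 15 = (z - x) mod 15"
    unfolding b_def c_def mod_add_eq by simp
  moreover have "(b + c + d) mod 15 = ((b + c) mod 15 + d) mod 15"
    by (simp only: mod_add_left_eq)
  ultimately have "(b + c + d) mod 15 = ((z - x) mod 15 + (x - z) mod 15) mod 15"
    by (simp only: d_def)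
  also have "\<dots> = 0" unfolding mod_add_eq by simp
  \<comment> \<open>The sum is a multiple of 15 between 3 and 18.\<close>
  finally have "b + c + d = 15"
    using bcd by auto
  moreover have "1 \<le> b" "b \<le> 6" "1 \<le> c" "c \<le> 6" "1 \<le> d" "d \<le> 6"
    using bcd by auto
  \<comment> \<open>Apart from 5, 5, 5, some 6 has a 5 or a 6 as a cyclic neighbor; a reflection, if
    needed, puts that neighbor behind it.\<close>
  ultimately have "b = 5 \<and> c = 5 \<and> d = 5 \<or> b = 6 \<and> (c = 5 \<or> c = 6) \<or> c = 6 \<and> (d = 5 \<or> d = 6) \<or>
      d = 6 \<and> (b = 5 \<or> b = 6) \<or> d = 6 \<and> c = 5 \<or> c = 6 \<and> b = 5 \<or> b = 6 \<and> d = 5"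
    by presburger
  then consider "b = 5" "c = 5" "d = 5"
    | "b = 6 \<and> c \<in> {5, 6}" | "c = 6 \<and> d \<in> {5, 6}" | "d = 6 \<and> b \<in> {5, 6}"
    | "d = 6 \<and> c = 5" | "c = 6 \<and> b = 5" | "b = 6 \<and> d = 5"
    by blast
  then show ?thesis
  proof cases
    case 1
    note gaps = 1[unfolded b_def c_def d_def] mirror_gaps[unfolded 1]
    \<comment> \<open>Three of the six orders are rotations of the required one, the others of its
      mirror image.\<close>
    consider "h x \<le> h y \<and> h y \<le> h z" | "h y \<le> h z \<and> h z \<le> h x" | "h z \<le> h x \<and> h x \<le> h y"
      | "h x \<le> h z \<and> h z \<le> h y" | "h z \<le> h y \<and> h y \<le> h x" | "h y \<le> h x \<and> h x \<le> h z"
      by linarith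
    then show ?thesis
      using direct mirror reflected gaps gval by cases metis+
  next
    case 2
    then show ?thesis using direct(1) by (auto simp: b_def c_def)
  next
    case 3
    then show ?thesis using direct(2) by (auto simp: c_def d_def)
  next
    case 4
    then show ?thesis using direct(3) by (auto simp: d_def b_def)
  next
    case 5
    then show ?thesis using mirror(1) reflected mirror_gaps by auto
  next
    case 6
    then show ?thesis using mirror(2) reflected mirror_gaps by auto
  next
    case 7
    then show ?thesis using mirror(3) reflected mirror_gaps by auto
  qed
qed

end

section \<open>Certificates\<close>

text \<open>Slice \<open>i\<close> is \<open>v\<close>-slice \<open>8 * i\<close>, because \<open>2 * 8 = 1\<close> modulo \<open>15\<close>; \<open>half j\<close> is the vector of the
  half-circle that starts at \<open>v\<^sub>j\<close>.\<close>

definition half :: "int \<Rightarrow> int list" where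
  "half j = map (\<lambda>i. if (8 * i - j) mod 15 \<le> 7 then - 5 else 4) [0..14]"

text \<open>A nonnegative product says that the half-circle from \<open>i\<close> is no larger than
  the one from \<open>j\<close>.\<close>

definition half_diff :: "int \<Rightarrow> int \<Rightarrow> int list" where
  "half_diff i j = map2 (-) (half i) (half j)"

definition single :: "nat \<Rightarrow> int \<Rightarrow> int list" where
  "single i x = (replicate 15 0)[i := x]"

text \<open>The inequalities describing the multiples of the cuttings \<open>P_cut \<omega>\<close>; the unit is slice \<open>2\<close>.\<close>

definition P_cut_cone :: "int list list" where
  "P_cut_cone =
    map (\<lambda>i. single i (- 1)) [0, 1, 3, 5, 6, 8, 10, 11, 13] @
    concat (map (\<lambda>(i, c). [(single 2 c)[i := - 1], (single 2 (- c))[i := 1]]) [(4, 1), (12, 2), (14, 2)]) @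
    [(single 2 (- 3))[7 := 1, 9 := 1], (single 2 3)[7 := - 1, 9 := - 1],
     (single 2 (- 1))[7 := 1], (single 2 (- 1))[9 := 1]]"

text \<open>The digits in the names are the gaps of the triple of half-circles.\<close>

definition cert_663 :: cert where
  "cert_663 =
    Play 13 [(14,6,True), (14,6,False)] [Farkas [0,4,5,6], Farkas [0,5], Farkas [0,6],
      Farkas [0,3,5], Farkas [0,2,5], Farkas [0,1,5]]"

definition cert_654 :: cert where
  "cert_654 =
    Play 13 [(14,6,True), (14,6,False)] [Farkas [0,4,5,6], Farkas [0,5], Farkas [0,6],
      Farkas [0,3,5], Farkas [0,2,5], Farkas [0,1,6]]"

text \<open>In each plan Alice jumps exactly once, in her second or third turn; arc starts are
  unreduced, whence 15 in place of 0. The cuttings \<open>P_cut \<omega>\<close> end up in the only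
  \<open>Target\<close> leaf, whose 19 entries follow the order of
  \<open>P_cut_cone\<close>.\<close>

definition cert_555 :: cert where
  "cert_555 =
    Play 2 [(5,5,True), (5,5,False), (3,6,False)] [Farkas [0,6,7,7,8,8,8], Farkas [0,7,8],
      Farkas [0,8], Farkas [0,4,8], Farkas [0,5,7,8], Farkas [0,3,6,7,8],
      Play 4 [(5,6,True), (5,5,True), (5,5,False)] [Farkas [0,1,7,8,9,9], Farkas [0,9],
        Farkas [0,1], Farkas [0,1,6], Farkas [0,5,9], Farkas [0,7,8,8,9,9,9], Farkas [0,8,9],
        Farkas [0,6,8,9],
        Play 7 [(10,5,True), (10,5,False), (8,6,False)] [Farkas [0,1,2,2,8,10,10], Farkas [0,10],
          Farkas [0,3,10], Farkas [0,2,7], Farkas [0,1,2,8,10], Farkas [0,1,1,2,2,8,10,10,10],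
          Farkas [0,1,2,7,10],
          Play 12 [(15,5,True), (15,5,False), (13,6,False)] [Farkas [0,1,2,3,11,11],
            Farkas [0,2,2,3,9,11,11], Farkas [0,2,3,9,11], Farkas [0,4,11], Farkas [0,2,3,11],
            Play 14 [(15,6,True), (15,5,True), (15,5,False)] [Farkas [0,1,2,12],
              Farkas [0,1,3,10,12], Farkas [0,3,4,12], Farkas [0,1,10], Farkas [0,2,3,4,12,12],
              Farkas [0,3,3,4,10,12,12], Farkas [0,1], Farkas [0,3,4,10,12]],
            Play 14 [(15,6,True), (15,6,False)] [Farkas [0,1,2,3,12,12], Farkas [0,1,3,3,10,12,12],
              Farkas [0,1,3,12], Farkas [0,3,4,12], Farkas [0,1,3,10,12]],
            Play 14 [(15,6,True), (15,6,False)] [Farkas [0,1,2,3,3,4,4,12,12,12,12],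
              Farkas [0,1,2,12], Farkas [0,1,2,3,12,12]],
            Play 14 [(15,6,True), (15,5,True), (15,5,False)] [Farkas [0,1,2,3,3,4,4,12,12,12,12],
              Farkas [0,3,4,12], Farkas [0,1], Farkas [0,1,3,12], Farkas [0,3,4,10,12],
              Farkas [0,3,3,4,10,12,12],
              Play 9 [(10,6,True), (10,5,True), (10,5,False)] [Farkas [0,1,3,4,4,5,5,13,13,13,13],
                Farkas [0,1,2,4,5,13], Farkas [0,13], Farkas [0,3,5,13], Farkas [0,3],
                Farkas [0,1,2,4,5,5,13,13], Target [(8,[1,2,4,4,5,5,13,13,13]),
                (8,[1,2,4,4,5,5,13,13,13]), (23,[1,2,4,4,5,5,13,13,13]), (8,[1,2,4,4,5,5,13,13,13]),
                (8,[1,2,4,4,5,5,13,13,13]), (8,[1,2,4,4,5,5,13,13,13]), (8,[1,2,4,4,5,5,13,13,13]),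
                (8,[1,2,4,4,5,5,13,13,13]), (15,[1,2,4,4,5,5,13,13,13]), (9,[1,2,4,4,4,5,13,13,13]),
                (9,[1,2,4,5,5,5,13,13,13]), (9,[2,4,4,4,5,13,13,13,13]),
                (9,[1,1,1,2,2,4,4,4,5,5,5,5,5,13,13,13,13,13]), (9,[1,4,4,4,5,13,13,13,13]),
                (9,[1,1,2,2,2,4,4,4,5,5,5,5,5,13,13,13,13,13]),
                (9,[1,1,1,1,2,2,2,2,4,4,4,4,5,5,5,5,5,5,5,13,13,13,13,13,13,13,13]),
                (9,[4,4,4,4,5,13,13,13,13]), (9,[0,1,2,4,5,5,13,13,13]),
                (9,[1,2,3,4,5,5,13,13,13])]]]],
          Play 14 [(15,6,True), (15,5,True), (15,5,False)] [Farkas [0,1,2,8,11],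
            Farkas [0,1,2,3,11,11], Farkas [0,2,3,11], Farkas [0,1,8], Farkas [0,2,2,3,9,11,11],
            Farkas [0,1,2,3,4,11,11], Farkas [0,2,3,9,11],
            Play 9 [(10,6,True), (10,6,False)] [Farkas [0,1,2,3,3,4,4,12,12,12,12],
              Farkas [0,1,2,3,4,12], Farkas [0,1,2,3,4,9,12], Farkas [0,1,2,3,4,4,12,12]]],
          Play 9 [(10,6,True), (10,6,False)] [Farkas [0,1,2,3,3,9,11], Farkas [0,1], Farkas [0,1,4],
            Farkas [0,1,2,3,9], Farkas [0,2,3,9,11], Farkas [0,1,2,2,3,3,9,11,11]]],
        Play 12 [(13,6,True), (13,6,False)] [Farkas [0,1,1,2,6,8,10,10], Farkas [0,1,2,10],
          Farkas [0,1,2,8,10], Farkas [0,1,2,4,10], Farkas [0,1,2,6,8,10],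
          Farkas [0,1,1,2,2,6,8,10,10,10]]],
      Play 4 [(5,6,True), (5,6,False)] [Farkas [0,1,7,8,8,9,9], Farkas [0,1], Farkas [0,9],
        Farkas [0,1,8], Farkas [0,1,5], Farkas [0,1,6,8]],
      Play 4 [(5,6,True), (5,6,False)] [Farkas [0,1,6,7,8,8,9,9], Farkas [0,9], Farkas [0,1,6],
        Farkas [0,1,6,8], Farkas [0,1,5,6], Farkas [0,1,6,6,8]],
      Play 12 [(13,6,True), (13,6,False)] [Farkas [0,1,4,7,8,9,9], Farkas [0,1,4], Farkas [0,1,4,7],
        Farkas [0,1,3,4], Farkas [0,7,8,9], Farkas [0,1,4,4,7]]]"

text \<open>The context holds the half-circles of the triple and exchanges that keep all gaps within
  6: here the start 0 may move to 1, 2 or 3.\<close>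

lemma check_663:
  "check 15 P_cut_cone [half_diff 0 3, half_diff 0 2, half_diff 0 1, half 12, half 6, half 0] cert_663"
  by code_simp

lemma check_654:
  "check 15 P_cut_cone [half_diff 6 5, half_diff 0 2, half_diff 0 1, half 11, half 6, half 0] cert_654"
  by code_simp

text \<open>The exchanges move a start by one place. The differences \<open>half_diff 13 8\<close>
  and \<open>half_diff 8 3\<close> encode the order in \<open>normal_form\<close>, so
  \<open>half 3\<close> already implies the bounds for 8 and 13.\<close>

lemma check_555:
  "check 15 P_cut_cone [half_diff 13 14, half_diff 13 12, half_diff 8 9, half_diff 8 7, half_diff 3 4,
    half_diff 13 8, half_diff 8 3, half 3] cert_555"
  by code_simp

section \<open>Half-circles under rotation and reversal\<close>

lemma int_mod_diff:
  fixes u k n :: int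
  assumes "0 \<le> k" "k < n"
  shows "(u - k) mod n = (if k \<le> u mod n then u mod n - k else u mod n - k + n)"
proof -
  have "0 \<le> u mod n" "u mod n < n" using assms by simp_all
  moreover have "(u - k) mod n = (u mod n - k) mod n" by (simp add: mod_diff_left_eq)
  moreover have "(u mod n - k) mod n = (u mod n - k + n) mod n" by simp
  ultimately show ?thesis
    using assms by (smt (verit) mod_pos_pos_trivial)
qed

lemma twice_times_8_mod_15: "8 * ((2 * s) mod 15) mod 15 = s mod (15 :: int)"
proof -
  have "8 * ((2 * s) mod 15) mod 15 = (s + s * 15) mod 15"
    by (subst mod_mult_right_eq) simp
  then show ?thesis by (simp only: mod_mult_self1)
qed

lemma length_half [simp]: "length (half j) = 15"
  by (simp add: half_def)

lemma nth_half: "i < 15 \<Longrightarrow> half j ! i = (if (8 * int i - j) mod 15 \<le> 7 then - 5 else 4)"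
  by (simp add: half_def nth_upto)

lemma half_cong:
  assumes "j mod 15 = j' mod 15"
  shows "half j = half j'"
proof -
  have "(8 * i - j) mod 15 = (8 * i - j') mod 15" for i
    using assms by (metis mod_diff_right_eq)
  then show ?thesis by (simp add: half_def)
qed

definition half_excess :: "real list \<Rightarrow> int \<Rightarrow> real" where
  "half_excess P j = dot (half j) P"

lemma half_excess_cong: "j mod 15 = j' mod 15 \<Longrightarrow> half_excess P j = half_excess P j'"
  by (metis half_excess_def half_cong)

interpretation half_excess: periodic15 "half_excess P" for P
  by standard (rule half_excess_cong, simp)

text \<open>The next slice is eight places further in the \<open>v\<close>-order.\<close>

lemma half_excess_rotate1:
  assumes P: "length P = 15"
  shows "half_excess (rotate1 P) j = half_excess P (j + 8)"
proof -
  have "bij_betw (\<lambda>i. Suc i mod 15) {..<15} {..<15}"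
    by (rule bij_betw_byWitness[where f' = "\<lambda>i. (i + 14) mod 15"]) (auto simp: mod_simps)
  moreover have "half j ! i = half (j + 8) ! (Suc i mod 15)" if "i < 15" for i
  proof -
    have "(8 * int (Suc i mod 15) - (j + 8)) mod 15 = (8 * int i - j) mod 15"
    proof -
      have "(8 * ((1 + int i) mod 15) - (j + 8)) mod 15 = (8 * (1 + int i) - (j + 8)) mod 15"
        by (metis mod_diff_left_eq mod_mult_right_eq)
      then show ?thesis by (simp add: of_nat_mod algebra_simps)
    qed
    then show ?thesis using that by (simp add: nth_half)
  qed
  then have "half_excess (rotate1 P) j =
      (\<Sum>i<15. of_int (half (j + 8) ! (Suc i mod 15)) * P ! (Suc i mod 15))"
    using P by (simp add: half_excess_def dot_def nth_rotate1)
  ultimately show ?thesis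
    using P sum.reindex_bij_betw[of "\<lambda>i. Suc i mod 15" "{..<15}" "{..<15}"
        "\<lambda>i. of_int (half (j + 8) ! i) * P ! i"]
    by (simp add: half_excess_def dot_def)
qed

lemma half_excess_rotate:
  "length P = 15 \<Longrightarrow> half_excess (rotate k P) j = half_excess P (j + 8 * int k)"
  by (induction k arbitrary: j) (simp_all add: half_excess_rotate1 algebra_simps)

lemma half_excess_rev:
  assumes P: "length P = 15"
  shows "half_excess (rev P) j = half_excess P (- j)"
proof -
  have "bij_betw (\<lambda>i. 14 - i) {..<15::nat} {..<15}"
    by (rule bij_betw_byWitness[where f' = "\<lambda>i. 14 - i"]) auto
  moreover have "half j ! i = half (- j) ! (14 - i)" if "i < 15" for i
  proof -
    \<comment> \<open>Slice \<open>14 - i\<close> is \<open>v\<close>-slice \<open>7 - 8 * i\<close>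
      modulo 15, and replacing \<open>u\<close> by \<open>7 - u\<close> permutes the offsets 0 to 7
      of a half-circle.\<close>
    have *: "(7 - u) mod 15 \<le> 7 \<longleftrightarrow> u mod 15 \<le> 7" for u :: int
    proof -
      have "(7 - u) mod 15 = (7 - u mod 15) mod 15" by (simp add: mod_diff_right_eq)
      then show ?thesis
        using int_mod_diff[of "u mod 15" 15 7] by auto
    qed
    have "8 * int (14 - i) - - j = (7 - (8 * int i - j)) + 15 * 7"
      using that by (simp add: of_nat_diff)
    then have "(8 * int (14 - i) - - j) mod 15 = (7 - (8 * int i - j)) mod 15"
      by (simp only: mod_mult_self2)
    then show ?thesis using that *[of "8 * int i - j"] by (simp only: nth_half)
  qed
  then have "half_excess (rev P) j = (\<Sum>i<15. of_int (half (- j) ! (14 - i)) * P ! (14 - i))"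
    using P by (simp add: half_excess_def dot_def rev_nth)
  ultimately show ?thesis
    using P sum.reindex_bij_betw[of "\<lambda>i. 14 - i" "{..<15}" "{..<15}"
        "\<lambda>i. of_int (half (- j) ! i) * P ! i"]
    by (simp add: half_excess_def dot_def)
qed

text \<open>With the empty plan Alice only shifts. The range of \<open>t\<close> says that her
  half-circle contains her first slice, \<open>v\<close>-slice \<open>8 * i\<close>.\<close>

lemma half_outcomes:
  "\<forall>i\<in>set [0..<15]. \<forall>v\<in>set (outcomes 15 i []). \<exists>t\<in>set [0..7]. v = half (8 * int i - t)"
  by code_simp

lemma half_excess_cover:
  assumes "good_for_Bob P" "length P = 15"
  shows "\<exists>t\<in>{0..7}. 0 \<le> half_excess P (s - t)"
proof -
  \<comment> \<open>Alice starts with \<open>v\<^sub>s\<close>, which is slice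
    \<open>2 * s\<close>.\<close>
  define i where "i = nat ((2 * s) mod 15)"
  have i: "i < 15" "int i = (2 * s) mod 15" by (auto simp: i_def nat_less_iff)
  obtain v where "v \<in> set (outcomes 15 i [])" "0 \<le> dot v P"
    using good_for_Bob_outcomes[OF assms(1) _ assms(2) i(1), of "[]"] by auto
  then obtain t where "t \<in> {0..7}" "0 \<le> half_excess P (8 * int i - t)"
    using half_outcomes i(1) by (fastforce simp: half_excess_def)
  moreover have "8 * int i mod 15 = s mod 15"
    unfolding i(2) by (rule twice_times_8_mod_15)
  then have "(8 * int i - t) mod 15 = (s - t) mod 15" for t
    by (metis mod_diff_left_eq)
  ultimately show ?thesis using half_excess_cong by metis
qed

lemma dot_add:
  assumes "length v = length P" "length w = length P"
  shows "dot (map2 (+) v w) P = dot v P + dot w P"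
  using assms by (simp add: dot_def distrib_right sum.distrib)

lemma dot_diff:
  assumes "length v = length P" "length w = length P"
  shows "dot (map2 (-) v w) P = dot v P - dot w P"
  using assms by (simp add: dot_def left_diff_distrib sum_subtractf)

text \<open>The two half-circles cover the circle, so each entry of the sum is 4 - 5 or -5 -
  5.\<close>

lemma half_excess_opposite:
  assumes P: "length P = 15" "\<forall>x\<in>set P. 0 \<le> x" "0 < sum_list P" and d: "d \<in> {7, 8}"
  shows "half_excess P j + half_excess P (j + d) < 0"
proof -
  have "dot (map2 (+) (half j) (half (j + d))) P < 0"
  proof (rule dot_negative[OF _ P(2,3)])
    fix i assume i: "i < length P"
    have "u mod 15 \<le> 7 \<or> (u - 7) mod 15 \<le> 7" "u mod 15 \<le> 7 \<or> (u - 8) mod 15 \<le> 7" for u :: int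
      by (auto simp: int_mod_diff)
    from this[of "8 * int i - j"]
    have "(8 * int i - j) mod 15 \<le> 7 \<or> (8 * int i - (j + d)) mod 15 \<le> 7"
      using d by (auto simp: diff_diff_eq)
    then show "map2 (+) (half j) (half (j + d)) ! i < 0"
      using i P by (auto simp: nth_half)
  qed
  then show ?thesis
    using P by (simp add: dot_add half_excess_def)
qed

lemma good_for_Bob_normal_form:
  assumes good: "good_for_Bob P" and P: "length P = 15" "\<forall>x\<in>set P. 0 \<le> x" "0 < sum_list P"
  shows "\<exists>k. \<exists>Q\<in>{P, rev P}. normal_form (half_excess (rotate k Q))"
proof -
  obtain x y z where "best (half_excess P) x y z"
    using half_excess.candidate_exists[of P] half_excess.exists_best
      half_excess_cover[OF good P(1)] half_excess_opposite[OF P] by (metis insertI1 insertI2)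
  then obtain s where s: "normal_form (\<lambda>j. half_excess P (s + j)) \<or> normal_form (\<lambda>j. half_excess P (s - j))"
    using half_excess.best_normal by blast
  \<comment> \<open>Rotating by \<open>2 * s\<close> slices moves the \<open>v\<close>-order by
    \<open>16 * s\<close>, which is \<open>s\<close> modulo 15.\<close>
  have "half_excess P (s + j) = half_excess (rotate (nat ((2 * s) mod 15)) P) j" for j
  proof -
    have "(s + j) mod 15 = (j + 8 * ((2 * s) mod 15)) mod 15"
      using twice_times_8_mod_15[of s] by (metis add.commute mod_add_left_eq)
    then show ?thesis
      using P half_excess_cong[of "s + j" "j + 8 * ((2 * s) mod 15)" P]
      by (simp add: half_excess_rotate)
  qed
  moreover have "half_excess P (s - j) = half_excess (rotate (nat ((2 * (- s)) mod 15)) (rev P)) j" for j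
  proof -
    have "(s - j) mod 15 = (- j - 8 * ((2 * (- s)) mod 15)) mod 15"
    proof -
      have "(- j - 8 * ((2 * (- s)) mod 15)) mod 15 = (- j - (- s)) mod 15"
        using twice_times_8_mod_15[of "- s"] by (rule mod_diff_cong[OF refl])
      then show ?thesis by simp
    qed
    then show ?thesis
      using P half_excess_cong[of "s - j" "- j - 8 * ((2 * (- s)) mod 15)" P]
      by (simp add: half_excess_rotate half_excess_rev del: mult_minus_right)
  qed
  ultimately show ?thesis using s by auto
qed

section \<open>A one-jump strategy\<close>

text \<open>Bob moves, the arc of the slices \<open>a, \<dots>, a + 2 * m - 1\<close> remains, taking its left or right end
  counts as \<open>cl\<close> or \<open>cr\<close> jumps, \<open>k\<close> jumps are left, and Bob still has to collect \<open>x\<close> for the slice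
  sizes \<open>A\<close> and, by the same moves, \<open>y\<close> for the slice sizes \<open>B\<close>.\<close>

fun one_jump_win :: "int list \<Rightarrow> int list \<Rightarrow> nat \<Rightarrow> nat \<Rightarrow> nat \<Rightarrow> nat \<Rightarrow> nat \<Rightarrow> int \<Rightarrow> int \<Rightarrow> bool" where
  "one_jump_win A B cl cr k a 0 x y \<longleftrightarrow> x \<le> 0 \<and> y \<le> 0"
| "one_jump_win A B cl cr k a (Suc m) x y \<longleftrightarrow>
     cl \<le> k \<and>
     (let i = a mod length A; x' = x - A ! i; y' = y - B ! i in
       one_jump_win A B 0 1 (k - cl) (a + 2) m x' y' \<and>
       one_jump_win A B 1 0 (k - cl) (a + 1) m x' y') \<or>
     cr \<le> k \<and>
     (let i = (a + 2 * m + 1) mod length A; x' = x - A ! i; y' = y - B ! i in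
       one_jump_win A B 0 1 (k - cr) (a + 1) m x' y' \<and>
       one_jump_win A B 1 0 (k - cr) a m x' y')"

definition P_cut_0 :: "int list" where
  "P_cut_0 = [0, 0, 1, 0, 1, 0, 0, 1, 0, 2, 0, 0, 2, 0, 2]"

definition P_cut_1 :: "int list" where
  "P_cut_1 = [0, 0, 1, 0, 1, 0, 0, 2, 0, 1, 0, 0, 2, 0, 2]"

text \<open>Seven rounds follow Alice's first slice, both ends are next to it and hence free, and 5
  is five ninths of the total size 9.\<close>

lemma one_jump_win_P_cut:
  "\<forall>i\<in>set [0..<15]. one_jump_win P_cut_0 P_cut_1 0 0 1 (Suc i) 7 5 5"
  by code_simp

section \<open>From the search to a strategy\<close>

lemma jumps_snoc:
  assumes "h \<noteq> []"
  shows "jumps pl n (h @ [i]) =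
    jumps pl n h + (if mover (length h) = pl \<and> \<not> adjacent n (last h) i then 1 else 0)"
proof -
  let ?J = "\<lambda>h. {k. 0 < k \<and> k < length h \<and> mover k = pl \<and> \<not> adjacent n (h ! (k - 1)) (h ! k)}"
  have "?J (h @ [i]) =
      ?J h \<union> (if mover (length h) = pl \<and> \<not> adjacent n (last h) i then {length h} else {})"
    using assms by (auto simp: less_Suc_eq nth_append last_conv_nth split: if_splits)
  moreover have "finite (?J h)" "length h \<notin> ?J h" by auto
  ultimately show ?thesis by (simp add: jumps_def)
qed

lemma one_jump_strategy:
  assumes n: "odd n" "length A = n" "length B = n"
    and win: "\<And>i. i < n \<Longrightarrow> one_jump_win A B 0 0 1 (Suc i) ((n - 1) div 2) g g"
    and P: "length P = n" "\<And>i. i < n \<Longrightarrow> P ! i = (1 - \<omega>) * of_int (A ! i) + \<omega> * of_int (B ! i)"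
    and \<omega>: "0 \<le> \<omega>" "\<omega> \<le> 1"
  shows "\<exists>\<sigma>. jump_strategy Bob 1 n \<sigma> \<and> has_gain Bob P \<sigma> (of_int g)"
proof -
  \<comment> \<open>Bob still owes the mixture of \<open>x\<close> and \<open>y\<close> with the
    weights that mix the sizes; jumps made and jumps left stay within 1; an end of cost 0 is next to
    the last slice, which is Alice's.\<close>
  define J where "J h \<longleftrightarrow> (\<exists>a m cl cr k x y. arc_left n h a (2 * m) \<and>
      one_jump_win A B cl cr k a m x y \<and> jumps Bob n h + k \<le> 1 \<and>
      of_int g \<le> taken_size Bob P h + ((1 - \<omega>) * of_int x + \<omega> * of_int y) \<and>
      (0 < m \<longrightarrow> (cl = 0 \<longrightarrow> adjacent n (last h) (a mod n)) \<and>
        (cr = 0 \<longrightarrow> adjacent n (last h) ((a + 2 * m - 1) mod n))))" for h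
  have J_I: "J h" if "arc_left n h a (2 * m)" "one_jump_win A B cl cr k a m x y"
      "jumps Bob n h + k \<le> 1"
      "of_int g \<le> taken_size Bob P h + ((1 - \<omega>) * of_int x + \<omega> * of_int y)"
      "0 < m \<Longrightarrow> cl = 0 \<Longrightarrow> adjacent n (last h) (a mod n)"
      "0 < m \<Longrightarrow> cr = 0 \<Longrightarrow> adjacent n (last h) ((a + 2 * m - 1) mod n)"
    for h a m cl cr k x y
    unfolding J_def using that by blast
  have start: "J [i]" if i: "i < n" for i
  proof (rule J_I[OF _ win[OF i]])
    show "arc_left n [i] (Suc i) (2 * ((n - 1) div 2))"
      using arc_left_start[OF i] n by simp
    show "of_int g \<le> taken_size Bob P [i] + ((1 - \<omega>) * of_int g + \<omega> * of_int g)"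
      by (simp add: taken_size_def mover_def algebra_simps cong: conj_cong)
    show "jumps Bob n [i] + 1 \<le> 1" by (auto simp: jumps_def card_eq_0_iff)
    show "adjacent n (last [i]) (Suc i mod n)" by (simp add: adjacent_def)
    define q where "q = Suc i + 2 * ((n - 1) div 2) - 1"
    have "Suc q = i + n"
      using n i by (auto simp: q_def elim: oddE)
    then have "(q mod n + 1) mod n = i"
      using i by (simp add: mod_Suc_eq)
    then show "adjacent n (last [i]) ((Suc i + 2 * ((n - 1) div 2) - 1) mod n)"
      unfolding q_def[symmetric] by (simp add: adjacent_def)
  qed
  have step: "\<exists>i. legal_move n h i \<and> (\<forall>i'. legal_move n (h @ [i]) i' \<longrightarrow> J (h @ [i, i']))"
    if h: "position n h" "odd (length h)" "length h < n" "J h" for h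
  proof -
    obtain a m cl cr k x y where arc: "arc_left n h a (2 * m)"
      and w: "one_jump_win A B cl cr k a m x y" and jumps: "jumps Bob n h + k \<le> 1"
      and size: "of_int g \<le> taken_size Bob P h + ((1 - \<omega>) * of_int x + \<omega> * of_int y)"
      and adj: "0 < m \<longrightarrow> (cl = 0 \<longrightarrow> adjacent n (last h) (a mod n)) \<and>
        (cr = 0 \<longrightarrow> adjacent n (last h) ((a + 2 * m - 1) mod n))"
      using h(4) unfolding J_def by blast
    have "m \<noteq> 0" using arc h(3) by (auto simp: arc_left_def)
    then obtain m' where m': "m = Suc m'" by (cases m) auto
    have arc: "arc_left n h a (Suc (2 * m' + 1))" using arc m' by simp
    have "h \<noteq> []" using h(2) by auto
    \<comment> \<open>\<open>c\<close> is the cost of Bob's move and \<open>b\<close> the start of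
      the arc after it. Whichever end Alice then takes, the new end next to it is free and the other
      costs a jump.\<close>
    have cont: "\<exists>i. legal_move n h i \<and> (\<forall>i'. legal_move n (h @ [i]) i' \<longrightarrow> J (h @ [i, i']))"
      if i: "legal_move n h i" and arc': "arc_left n (h @ [i]) b (Suc (2 * m'))"
        and c: "c \<le> k" "c = 0 \<Longrightarrow> adjacent n (last h) i"
        and w1: "one_jump_win A B 0 1 (k - c) (Suc b) m' (x - A ! i) (y - B ! i)"
        and w2: "one_jump_win A B 1 0 (k - c) b m' (x - A ! i) (y - B ! i)" for i b c
    proof (intro exI[of _ i] conjI allI impI)
      fix i' assume "legal_move n (h @ [i]) i'"
      then have i': "i' = b mod n \<or> i' = (b + 2 * m') mod n"
        using legal_move_arc[OF arc'] by blast
      have "i < n" using i by (simp add: legal_move_def)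
      have jumps': "jumps Bob n (h @ [i, i']) + (k - c) \<le> 1"
        using jumps_snoc[of "h @ [i]" Bob n i'] jumps_snoc[OF \<open>h \<noteq> []\<close>, of Bob n i] jumps c h(2)
        by (cases "c = 0") (auto simp: mover_def split: if_splits)
      have "taken_size Bob P (h @ [i, i']) = taken_size Bob P h + P ! i"
        using taken_size_snoc[of Bob P "h @ [i]" i'] taken_size_snoc[of Bob P h i] h(2)
        by (simp add: mover_def)
      then have size': "of_int g \<le> taken_size Bob P (h @ [i, i']) +
          ((1 - \<omega>) * of_int (x - A ! i) + \<omega> * of_int (y - B ! i))"
        using size P(2)[OF \<open>i < n\<close>] by (simp add: algebra_simps)
      from i' show "J (h @ [i, i'])"
      proof
        assume i': "i' = b mod n"
        show ?thesis
        proof (rule J_I[OF _ w1 jumps' size'])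
          show "arc_left n (h @ [i, i']) (Suc b) (2 * m')"
            using arc_left_take_left[OF arc'] i' by simp
          show "adjacent n (last (h @ [i, i'])) (Suc b mod n)"
            by (simp add: adjacent_def i' mod_Suc_eq)
        qed simp
      next
        assume i': "i' = (b + 2 * m') mod n"
        show ?thesis
        proof (rule J_I[OF _ w2 jumps' size'])
          show "arc_left n (h @ [i, i']) b (2 * m')"
            using arc_left_take_right[OF arc'] i' by simp
          show "adjacent n (last (h @ [i, i'])) ((b + 2 * m' - 1) mod n)" if "0 < m'"
          proof -
            have "Suc (b + 2 * m' - 1) = b + 2 * m'" using that by simp
            then show ?thesis by (simp add: adjacent_def i' mod_Suc_eq)
          qed
        qed simp
      qed
    qed (rule i)
    consider
      (left) "cl \<le> k" "one_jump_win A B 0 1 (k - cl) (a + 2) m' (x - A ! (a mod n)) (y - B ! (a mod n))"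
        "one_jump_win A B 1 0 (k - cl) (a + 1) m' (x - A ! (a mod n)) (y - B ! (a mod n))"
    | (right) "cr \<le> k"
        "one_jump_win A B 0 1 (k - cr) (a + 1) m' (x - A ! ((a + 2 * m' + 1) mod n)) (y - B ! ((a + 2 * m' + 1) mod n))"
        "one_jump_win A B 1 0 (k - cr) a m' (x - A ! ((a + 2 * m' + 1) mod n)) (y - B ! ((a + 2 * m' + 1) mod n))"
      using w n(2) unfolding m' by (auto simp: Let_def)
    then show ?thesis
    proof cases
      case left
      then show ?thesis
        using cont[of "a mod n" "Suc a" cl] legal_move_arc[OF arc] arc_left_take_left[OF arc] adj m'
        by simp
    next
      case right
      then show ?thesis
        using cont[of "(a + 2 * m' + 1) mod n" a cr] legal_move_arc[OF arc] arc_left_take_right[OF arc] adj m'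
        by simp
    qed
  qed
  obtain \<sigma> where \<sigma>: "strategy Bob n \<sigma>" "\<And>h. game_with Bob n \<sigma> h \<Longrightarrow> J h"
    using strategy_from_invariant[of n J, OF start step] n(1) by blast
  have "jumps Bob n h \<le> 1 \<and> of_int g \<le> taken_size Bob P h" if h: "game_with Bob n \<sigma> h" for h
  proof -
    obtain a m cl cr k x y where arc: "arc_left n h a (2 * m)"
      and w: "one_jump_win A B cl cr k a m x y" and jumps: "jumps Bob n h + k \<le> 1"
      and size: "of_int g \<le> taken_size Bob P h + ((1 - \<omega>) * of_int x + \<omega> * of_int y)"
      using \<sigma>(2)[OF h] unfolding J_def by blast
    have "m = 0" using arc h by (auto simp: arc_left_def game_with_def)
    then have "(1 - \<omega>) * of_int x + \<omega> * of_int y \<le> 0"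
      using w \<omega> by (intro add_nonpos_nonpos mult_nonneg_nonpos) auto
    then show ?thesis using size jumps by simp
  qed
  then show ?thesis
    using \<sigma>(1) P(1) by (auto simp: jump_strategy_def has_gain_def)
qed

lemma P_cut_one_jump:
  assumes "\<omega> \<in> {0..1}"
  shows "\<exists>\<sigma>. jump_strategy Bob 1 15 \<sigma> \<and> has_gain Bob (P_cut \<omega>) \<sigma> 5"
proof -
  have "\<exists>\<sigma>. jump_strategy Bob 1 15 \<sigma> \<and> has_gain Bob (P_cut \<omega>) \<sigma> (of_int 5)"
  proof (rule one_jump_strategy)
    show "one_jump_win P_cut_0 P_cut_1 0 0 1 (Suc i) ((15 - 1) div 2) 5 5" if "i < 15" for i
      using one_jump_win_P_cut that by simp
    show "P_cut \<omega> ! i = (1 - \<omega>) * of_int (P_cut_0 ! i) + \<omega> * of_int (P_cut_1 ! i)"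
      if "i < 15" for i
      using that unfolding P_cut_def P_cut_0_def P_cut_1_def
      by (auto simp: less_Suc_eq numeral_eq_Suc algebra_simps)
  qed (use assms in \<open>auto simp: P_cut_def P_cut_0_def P_cut_1_def\<close>)
  then show ?thesis by simp
qed

section \<open>Uniqueness\<close>

lemma dot_Nil: "dot v [] = 0"
  by (simp add: dot_def)

lemma dot_Cons: "dot (c # v) (x # P) = of_int c * x + dot v P"
  by (simp add: dot_def sum.lessThan_Suc_shift del: sum.lessThan_Suc)

lemma P_cut_cone_multiple:
  assumes cone: "\<And>t. t \<in> set P_cut_cone \<Longrightarrow> 0 \<le> dot t Q"
    and Q: "length Q = 15" "\<forall>x\<in>set Q. 0 \<le> x" "0 < sum_list Q"
  shows "\<exists>\<omega>\<in>{0..1}. \<exists>c>0. Q = map (\<lambda>x. c * x) (P_cut \<omega>)"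
proof -
  obtain p0 p1 p2 p3 p4 p5 p6 p7 p8 p9 p10 p11 p12 p13 p14
    where Q_eq: "Q = [p0, p1, p2, p3, p4, p5, p6, p7, p8, p9, p10, p11, p12, p13, p14]"
    using Q(1) by (auto simp: length_Suc_conv eval_nat_numeral)
  have "\<forall>t\<in>set P_cut_cone. 0 \<le> dot t Q" using cone by blast
  then have "p0 \<le> 0" "p1 \<le> 0" "p3 \<le> 0" "p5 \<le> 0" "p6 \<le> 0" "p8 \<le> 0" "p10 \<le> 0" "p11 \<le> 0" "p13 \<le> 0"
    and units: "p4 = p2" "p12 = 2 * p2" "p14 = 2 * p2" "p9 = 3 * p2 - p7" "p2 \<le> p7" "p7 \<le> 2 * p2"
    unfolding Q_eq P_cut_cone_def single_def
    by (simp_all add: eval_nat_numeral dot_Cons dot_Nil)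
  then have zero: "p0 = 0" "p1 = 0" "p3 = 0" "p5 = 0" "p6 = 0" "p8 = 0" "p10 = 0" "p11 = 0" "p13 = 0"
    using Q(2) by (auto simp: Q_eq)
  \<comment> \<open>Otherwise every size would be 0.\<close>
  have "0 < p2"
    using Q(2,3) zero units by (auto simp: Q_eq)
  \<comment> \<open>Slice 7 has size \<open>1 + \<omega>\<close> in units of slice 2.\<close>
  define \<omega> where "\<omega> = p7 / p2 - 1"
  have \<omega>: "p7 = p2 * (1 + \<omega>)" using \<open>0 < p2\<close> by (simp add: \<omega>_def)
  then have "p9 = p2 * (2 - \<omega>)" using units(4) by (simp add: algebra_simps)
  then have "Q = map (\<lambda>x. p2 * x) (P_cut \<omega>)"
    using zero units(1-3) \<omega> by (simp add: Q_eq P_cut_def)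
  moreover have "\<omega> \<in> {0..1}"
    using units(5,6) \<open>0 < p2\<close> by (simp add: \<omega>_def field_simps)
  ultimately show ?thesis using \<open>0 < p2\<close> by blast
qed

lemma half_diff_best:
  assumes "best (half_excess Q) x y z" "spread x' y z" "length Q = 15"
  shows "0 \<le> dot (half_diff x x') Q"
  using best_exchange[OF assms(1,2)] assms(3)
  by (simp add: half_diff_def dot_diff half_excess_def)

lemma normal_form_multiple:
  assumes good: "good_for_Bob Q" and Q: "length Q = 15" "\<forall>x\<in>set Q. 0 \<le> x" "0 < sum_list Q"
    and "normal_form (half_excess Q)"
  shows "\<exists>\<omega>\<in>{0..1}. \<exists>c>0. Q = map (\<lambda>x. c * x) (P_cut \<omega>)"
proof -
  have sound: ?thesis if "check 15 P_cut_cone C c" "\<forall>v\<in>set C. length v = 15 \<and> 0 \<le> dot v Q" for C c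
    using check_sound[OF good, of P_cut_cone C c] that Q
    by (intro P_cut_cone_multiple) auto
  have len: "length (half_diff i j) = 15" for i j by (simp add: half_diff_def)
  have nonneg: "0 \<le> dot (half x) Q" "0 \<le> dot (half y) Q" "0 \<le> dot (half z) Q"
    if "best (half_excess Q) x y z" for x y z
    using that by (auto simp: best_def candidate_def half_excess_def)
  have exchange: "0 \<le> dot (half_diff x x') Q"
    if "best (half_excess Q) x y z" "spread x' y z" for x x' y z
    using half_diff_best that Q(1) .
  from assms(5) consider
    "best (half_excess Q) 0 6 11" | "best (half_excess Q) 0 6 12"
    | "best (half_excess Q) 3 8 13" "half_excess Q 3 \<le> half_excess Q 8" "half_excess Q 8 \<le> half_excess Q 13"
    unfolding normal_form_def by blast
  then show ?thesis
  proof cases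
    case 1
    \<comment> \<open>Exchanging 6 for 5 concerns the second start, which \<open>best_cycle\<close>
      brings to the front.\<close>
    show ?thesis
      by (rule sound[OF check_654])
        (simp add: len nonneg[OF 1] exchange[OF 1] exchange[OF best_cycle[OF 1]] spread_def)
  next
    case 2
    show ?thesis
      by (rule sound[OF check_663]) (simp add: len nonneg[OF 2] exchange[OF 2] spread_def)
  next
    case 3
    note exch = exchange[OF 3(1)] exchange[OF best_cycle[OF 3(1)]]
      exchange[OF best_cycle[OF best_cycle[OF 3(1)]]]
    have "0 \<le> dot (half_diff 13 8) Q" "0 \<le> dot (half_diff 8 3) Q"
      using 3(2,3) Q(1) by (simp_all add: half_diff_def dot_diff half_excess_def)
    then show ?thesis
      by (intro sound[OF check_555]) (simp add: len nonneg[OF 3(1)] exch spread_def)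
  qed
qed

lemma similar_P_cut:
  assumes good: "good_for_Bob P" and P: "length P = 15" "\<forall>x\<in>set P. 0 \<le> x" "0 < sum_list P"
  shows "\<exists>\<omega>\<in>{0..1}. similar P (P_cut \<omega>)"
proof -
  obtain k Q where Q: "Q = P \<or> Q = rev P" and normal: "normal_form (half_excess (rotate k Q))"
    using good_for_Bob_normal_form[OF assms] by auto
  have sum: "sum_list (rotate k Q) = sum_list Q"
    unfolding rotate_drop_take by (metis add.commute append_take_drop_id sum_list_append)
  have "sum_list Q = sum_list P" "good_for_Bob Q" "length Q = 15" "set Q = set P"
    using Q P good good_for_Bob_rev by auto
  then obtain \<omega> c where \<omega>: "\<omega> \<in> {0..1}" "0 < c" "rotate k Q = map (\<lambda>x. c * x) (P_cut \<omega>)"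
    using normal_form_multiple[OF good_for_Bob_rotate _ _ _ normal] P sum by auto
  obtain j R where R: "R = P_cut \<omega> \<or> R = rev (P_cut \<omega>)" "rotate j P = map (\<lambda>x. c * x) R"
    using Q
  proof
    assume "Q = rev P"
    \<comment> \<open>Rotating the reversal forwards is reversing the backward rotation.\<close>
    then have "rotate (15 - k mod 15) P = map (\<lambda>x. c * x) (rev (P_cut \<omega>))"
      using \<omega>(3) P(1) by (simp add: rotate_rev rev_swap flip: rev_map)
    then show ?thesis using that by blast
  qed (use \<omega>(3) that in blast)
  \<comment> \<open>Fifteen single rotations are the identity, so \<open>l\<close> undoes
    \<open>j\<close>.\<close>
  define l where "l = 15 - j mod 15"
  have "rotate l (rotate j P) = rotate ((l + j) mod 15) P"
    using P(1) by (metis rotate_conv_mod rotate_rotate)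
  also have "(l + j) mod 15 = 0"
    unfolding l_def by presburger
  finally have "P = map (\<lambda>x. c * x) (rotate l R)"
    using R(2) by (simp add: rotate_map)
  then have "similar P (P_cut \<omega>)"
    using R(1) \<omega>(2) by (auto simp: similar_def)
  then show ?thesis using \<omega>(1) by blast
qed

lemma P_cut_size: "length (P_cut \<omega>) = 15" "sum_list (P_cut \<omega>) = 9"
  by (simp_all add: P_cut_def)

text \<open>Positive total size excludes the zero cutting, for which every strategy has the gain
  although it is similar to no \<open>P_cut \<omega>\<close>.\<close>

theorem theorem4:
  shows "(\<forall>\<omega>\<in>{0..1}. \<exists>\<sigma>. jump_strategy Bob 1 (length (P_cut \<omega>)) \<sigma> \<and>
             has_gain Bob (P_cut \<omega>) \<sigma> (5 * sum_list (P_cut \<omega>) / 9)) \<and>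
         (\<forall>P. pizza P \<and> length P = 15 \<and> 0 < sum_list P \<longrightarrow>
             ((\<exists>\<sigma>. strategy Bob (length P) \<sigma> \<and> has_gain Bob P \<sigma> (5 * sum_list P / 9)) \<longleftrightarrow>
              (\<exists>\<omega>\<in>{0..1}. similar P (P_cut \<omega>))))"
proof -
  have jump: "\<forall>\<omega>\<in>{0..1}. \<exists>\<sigma>. jump_strategy Bob 1 (length (P_cut \<omega>)) \<sigma> \<and>
      has_gain Bob (P_cut \<omega>) \<sigma> (5 * sum_list (P_cut \<omega>) / 9)"
    using P_cut_one_jump by (simp add: P_cut_size)
  then have "good_for_Bob (P_cut \<omega>)" if "\<omega> \<in> {0..1}" for \<omega>
    using that unfolding good_for_Bob_def jump_strategy_def by blast
  then have "good_for_Bob P \<longleftrightarrow> (\<exists>\<omega>\<in>{0..1}. similar P (P_cut \<omega>))"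
    if "pizza P" "length P = 15" "0 < sum_list P" for P
    using that similar_P_cut good_for_Bob_similar by (auto simp: pizza_def)
  then show ?thesis
    using jump unfolding good_for_Bob_def by blast
qed

end
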